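(* Let $(M, g, J)$ be a compact Kähler manifold (without boundary) of real dimension $2n$ and let $f : M \to \mathbb{R}$ be a smooth function such that $(g, f)$ is an extremal Kähler-Ricci soliton. If $g$ has positive holomorphic sectional curvature, then $g$ is Einstein.
   Context: $(M,g,J)$ is a smooth compact Kähler manifold without boundary, with Riemannian metric $g$ and compatible integrable complex structure $J$; $\mathrm{Ric}$ is the Riemannian Ricci tensor, $s$ the Riemannian scalar curvature, and $\nabla u = (du)^\sharp$ the Riemannian gradient of a smooth real function $u$. The pair $(g,f)$ is a Kähler-Ricci soliton if $\mathrm{Ric} - g = \frac12 \mathcal{L}_{\nabla f} g$, where $\mathcal{L}$ is the Lie derivative. For a real function $u$, $\partial^\sharp u = \frac12(\nabla u - iJ\nabla u)$ denotes the $(1,0)$-part of $\nabla u$. The metric $g$ is (Calabi) extremal if $\nabla s$ is holomorphic, i.e. $\bar\partial \partial^\sharp s = 0$. The pair $(g,f)$ is an extremal Kähler-Ricci soliton if it is a Kähler-Ricci soliton and $g$ is Calabi extremal. Positive holomorphic sectional curvature means that $g(\mathrm{Rm}(U,JU)JU,U) > 0$ for every nonzero real tangent vector $U$, where $\mathrm{Rm}(A,B)C = \nabla_A\nabla_B C - \nabla_B\nabla_A C - \nabla_{[A,B]}C$ is the Riemann curvature tensor. Einstein means that $\mathrm{Ric}$ is a constant multiple of $g$. *)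

theory Defs
  imports "HOL-Analysis.Analysis"
begin

section \<open>Smooth manifolds\<close>

text \<open>Class $C^k$ and smoothness on an open set; in finite dimension it suffices that the
  function is differentiable and all its directional derivatives are of class $C^{k-1}$.\<close>

primrec Ck_on :: "nat \<Rightarrow> ('a::euclidean_space \<Rightarrow> 'b::real_normed_vector) \<Rightarrow> 'a set \<Rightarrow> bool" where
  "Ck_on 0 f S \<longleftrightarrow> continuous_on S f"
| "Ck_on (Suc k) f S \<longleftrightarrow>
     (\<forall>x\<in>S. f differentiable (at x)) \<and> (\<forall>v. Ck_on k (\<lambda>x. frechet_derivative f (at x) v) S)"

definition smooth_on :: "('a::euclidean_space \<Rightarrow> 'b::real_normed_vector) \<Rightarrow> 'a set \<Rightarrow> bool" where
  "smooth_on f S \<longleftrightarrow> (\<forall>k. Ck_on k f S)"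

text \<open>A chart is a pair of its domain and its coordinate map into the model space \<open>'e\<close>.\<close>

type_synonym ('m, 'e) chart = "'m set \<times> ('m \<Rightarrow> 'e)"

definition chart_image :: "('m, 'e) chart \<Rightarrow> 'e set" where
  "chart_image c = snd c ` fst c"

definition chart_inv :: "('m, 'e) chart \<Rightarrow> 'e \<Rightarrow> 'm" where
  "chart_inv c = inv_into (fst c) (snd c)"

definition transition :: "('m, 'e) chart \<Rightarrow> ('m, 'e) chart \<Rightarrow> 'e \<Rightarrow> 'e" where
  "transition c d = snd d \<circ> chart_inv c"

definition smooth_manifold :: "'m topology \<Rightarrow> ('m, 'e::euclidean_space) chart set \<Rightarrow> bool" where
  "smooth_manifold T \<A> \<longleftrightarrow>
     Hausdorff_space T \<and> second_countable T \<and>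
     (\<Union>c\<in>\<A>. fst c) = topspace T \<and>
     (\<forall>c\<in>\<A>. openin T (fst c) \<and> open (chart_image c) \<and>
        homeomorphic_map (subtopology T (fst c)) (top_of_set (chart_image c)) (snd c)) \<and>
     (\<forall>c\<in>\<A>. \<forall>d\<in>\<A>. smooth_on (transition c d) (snd c ` (fst c \<inter> fst d)))"

definition smooth_function ::
  "('m, 'e::euclidean_space) chart set \<Rightarrow> ('m \<Rightarrow> real) \<Rightarrow> bool" where
  "smooth_function \<A> f \<longleftrightarrow> (\<forall>c\<in>\<A>. smooth_on (f \<circ> chart_inv c) (chart_image c))"

section \<open>Riemannian geometry in a coordinate domain\<close>

text \<open>A tensor field on a coordinate domain is given by its values at the points of the domain,
  tangent vectors being elements of \<open>'e\<close>: \<open>G x u v\<close> is the metric and \<open>J x u\<close> the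
  complex structure at \<open>x\<close>. Operators which are defined on vector fields and turn
  out to be tensorial are evaluated on tangent vectors by extending these to
  constant fields in the coordinates.\<close>

type_synonym 'e bilinear_field = "'e \<Rightarrow> 'e \<Rightarrow> 'e \<Rightarrow> real"

definition lie_bracket ::
  "('e::euclidean_space \<Rightarrow> 'e) \<Rightarrow> ('e \<Rightarrow> 'e) \<Rightarrow> 'e \<Rightarrow> 'e" where
  "lie_bracket X Y x = frechet_derivative Y (at x) (X x) - frechet_derivative X (at x) (Y x)"

definition lie_derivative ::
  "('e::euclidean_space \<Rightarrow> 'e) \<Rightarrow> 'e bilinear_field \<Rightarrow> 'e bilinear_field" where
  "lie_derivative X G x u v =
     frechet_derivative (\<lambda>y. G y u v) (at x) (X x)
       - G x (lie_bracket X (\<lambda>_. u) x) v - G x u (lie_bracket X (\<lambda>_. v) x)"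

definition sharp :: "'e bilinear_field \<Rightarrow> 'e \<Rightarrow> ('e \<Rightarrow> real) \<Rightarrow> 'e::euclidean_space" where
  "sharp G x \<alpha> = (THE v. \<forall>w. G x v w = \<alpha> w)"

definition grad :: "'e bilinear_field \<Rightarrow> ('e \<Rightarrow> real) \<Rightarrow> 'e \<Rightarrow> 'e::euclidean_space" where
  "grad G u x = sharp G x (frechet_derivative u (at x))"

text \<open>The Christoffel symbols of the Levi-Civita connection, by the Koszul formula for
  constant fields.\<close>

definition christoffel :: "'e bilinear_field \<Rightarrow> 'e \<Rightarrow> 'e \<Rightarrow> 'e \<Rightarrow> 'e::euclidean_space" where
  "christoffel G x u v = sharp G x (\<lambda>w.
     (frechet_derivative (\<lambda>y. G y v w) (at x) u
      + frechet_derivative (\<lambda>y. G y u w) (at x) v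
      - frechet_derivative (\<lambda>y. G y u v) (at x) w) / 2)"

definition cov :: "'e bilinear_field \<Rightarrow> ('e \<Rightarrow> 'e) \<Rightarrow> ('e \<Rightarrow> 'e) \<Rightarrow> 'e \<Rightarrow> 'e::euclidean_space" where
  "cov G X Y x = frechet_derivative Y (at x) (X x) + christoffel G x (X x) (Y x)"

definition curvature ::
  "'e bilinear_field \<Rightarrow> ('e \<Rightarrow> 'e) \<Rightarrow> ('e \<Rightarrow> 'e) \<Rightarrow> ('e \<Rightarrow> 'e) \<Rightarrow> 'e \<Rightarrow> 'e::euclidean_space" where
  "curvature G A B C x =
     cov G A (cov G B C) x - cov G B (cov G A C) x - cov G (lie_bracket A B) C x"

definition Rm :: "'e bilinear_field \<Rightarrow> 'e \<Rightarrow> 'e \<Rightarrow> 'e \<Rightarrow> 'e \<Rightarrow> 'e::euclidean_space" where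
  "Rm G x u v w = curvature G (\<lambda>_. u) (\<lambda>_. v) (\<lambda>_. w) x"

text \<open>Traces of endomorphisms do not depend on the basis, so the standard basis of \<open>'e\<close>,
  which need not be orthonormal for \<open>G\<close>, may be used.\<close>

definition endo_trace :: "('e \<Rightarrow> 'e::euclidean_space) \<Rightarrow> real" where
  "endo_trace A = (\<Sum>b\<in>Basis. A b \<bullet> b)"

definition Ric :: "'e::euclidean_space bilinear_field \<Rightarrow> 'e bilinear_field" where
  "Ric G x u v = endo_trace (\<lambda>w. Rm G x w u v)"

definition scal :: "'e::euclidean_space bilinear_field \<Rightarrow> 'e \<Rightarrow> real" where
  "scal G x = endo_trace (\<lambda>u. sharp G x (Ric G x u))"

section \<open>Complex geometry in a coordinate domain\<close>

definition nijenhuis ::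
  "('e \<Rightarrow> 'e \<Rightarrow> 'e) \<Rightarrow> 'e \<Rightarrow> 'e \<Rightarrow> 'e \<Rightarrow> 'e::euclidean_space" where
  "nijenhuis J x u v =
     lie_bracket (\<lambda>y. J y u) (\<lambda>y. J y v) x
       - J x (lie_bracket (\<lambda>y. J y u) (\<lambda>_. v) x)
       - J x (lie_bracket (\<lambda>_. u) (\<lambda>y. J y v) x)
       - lie_bracket (\<lambda>_. u) (\<lambda>_. v) x"

definition kahler_form ::
  "'e bilinear_field \<Rightarrow> ('e \<Rightarrow> 'e \<Rightarrow> 'e) \<Rightarrow> 'e bilinear_field" where
  "kahler_form G J x u v = G x (J x u) v"

text \<open>Exterior derivative of a 2-form; the bracket terms vanish for constant fields.\<close>

definition ext_deriv2 ::
  "'e::euclidean_space bilinear_field \<Rightarrow> 'e \<Rightarrow> 'e \<Rightarrow> 'e \<Rightarrow> 'e \<Rightarrow> real" where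
  "ext_deriv2 \<omega> x u v w =
     frechet_derivative (\<lambda>y. \<omega> y v w) (at x) u
     + frechet_derivative (\<lambda>y. \<omega> y w u) (at x) v
     + frechet_derivative (\<lambda>y. \<omega> y u v) (at x) w"

text \<open>Complexified tangent vectors: the pair \<open>(a, b)\<close> stands for $a + i b$, and \<open>J\<close> and the
  Lie bracket are extended complex linearly. \<open>part10\<close> and \<open>part01\<close> are
  $V \mapsto \frac12 (V - i J V)$ and $V \mapsto \frac12 (V + i J V)$.\<close>

definition part10 :: "('e \<Rightarrow> 'e \<Rightarrow> 'e) \<Rightarrow> 'e \<Rightarrow> 'e \<times> 'e \<Rightarrow> 'e \<times> 'e::euclidean_space" where
  "part10 J x V = (1/2) *\<^sub>R (fst V + J x (snd V), snd V - J x (fst V))"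

definition part01 :: "('e \<Rightarrow> 'e \<Rightarrow> 'e) \<Rightarrow> 'e \<Rightarrow> 'e \<times> 'e \<Rightarrow> 'e \<times> 'e::euclidean_space" where
  "part01 J x V = (1/2) *\<^sub>R (fst V - J x (snd V), snd V + J x (fst V))"

definition complex_bracket ::
  "('e::euclidean_space \<Rightarrow> 'e \<times> 'e) \<Rightarrow> ('e \<Rightarrow> 'e \<times> 'e) \<Rightarrow> 'e \<Rightarrow> 'e \<times> 'e" where
  "complex_bracket V W x =
     (lie_bracket (fst \<circ> V) (fst \<circ> W) x - lie_bracket (snd \<circ> V) (snd \<circ> W) x,
      lie_bracket (fst \<circ> V) (snd \<circ> W) x + lie_bracket (snd \<circ> V) (fst \<circ> W) x)"

definition del_sharp ::
  "'e bilinear_field \<Rightarrow> ('e \<Rightarrow> 'e \<Rightarrow> 'e) \<Rightarrow> ('e \<Rightarrow> real) \<Rightarrow> 'e \<Rightarrow> 'e \<times> 'e::euclidean_space" where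
  "del_sharp G J u x = part10 J x (grad G u x, 0)"

text \<open>The Dolbeault operator of the holomorphic tangent bundle $T^{1,0}$: for a (1,0)-field
  $Z$ and a (0,1)-field $W$ it is $\bar\partial_W Z = [W, Z]^{1,0}$, which is tensorial in $W$.
  Here $W$ is the (0,1)-part of a real vector \<open>u\<close>; all (0,1)-vectors are of this form.\<close>

definition dbar ::
  "('e \<Rightarrow> 'e \<Rightarrow> 'e) \<Rightarrow> ('e \<Rightarrow> 'e \<times> 'e) \<Rightarrow> 'e \<Rightarrow> 'e \<Rightarrow> 'e \<times> 'e::euclidean_space" where
  "dbar J Z x u = part10 J x (complex_bracket (\<lambda>y. part01 J y (u, 0)) Z x)"

section \<open>Kaehler manifolds and solitons\<close>

text \<open>Global tensor fields on a manifold are families of tensor fields on the chart images,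
  indexed by the charts of the atlas and related by the transition maps.\<close>

definition riemannian_metric ::
  "('m, 'e::euclidean_space) chart set \<Rightarrow> (('m, 'e) chart \<Rightarrow> 'e bilinear_field) \<Rightarrow> bool" where
  "riemannian_metric \<A> g \<longleftrightarrow>
     (\<forall>c\<in>\<A>. (\<forall>u v. smooth_on (\<lambda>x. g c x u v) (chart_image c)) \<and>
        (\<forall>x\<in>chart_image c. bilinear (g c x) \<and> (\<forall>u v. g c x u v = g c x v u) \<and>
           (\<forall>u. u \<noteq> 0 \<longrightarrow> g c x u u > 0))) \<and>
     (\<forall>c\<in>\<A>. \<forall>d\<in>\<A>. \<forall>p\<in>fst c \<inter> fst d. \<forall>u v.
        let D = frechet_derivative (transition c d) (at (snd c p))
        in g c (snd c p) u v = g d (snd d p) (D u) (D v))"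

definition almost_complex_structure ::
  "('m, 'e::euclidean_space) chart set \<Rightarrow> (('m, 'e) chart \<Rightarrow> 'e \<Rightarrow> 'e \<Rightarrow> 'e) \<Rightarrow> bool" where
  "almost_complex_structure \<A> J \<longleftrightarrow>
     (\<forall>c\<in>\<A>. (\<forall>u. smooth_on (\<lambda>x. J c x u) (chart_image c)) \<and>
        (\<forall>x\<in>chart_image c. linear (J c x) \<and> (\<forall>u. J c x (J c x u) = - u))) \<and>
     (\<forall>c\<in>\<A>. \<forall>d\<in>\<A>. \<forall>p\<in>fst c \<inter> fst d. \<forall>u.
        let D = frechet_derivative (transition c d) (at (snd c p))
        in D (J c (snd c p) u) = J d (snd d p) (D u))"

definition integrable_complex_structure ::
  "('m, 'e::euclidean_space) chart set \<Rightarrow> (('m, 'e) chart \<Rightarrow> 'e \<Rightarrow> 'e \<Rightarrow> 'e) \<Rightarrow> bool" where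
  "integrable_complex_structure \<A> J \<longleftrightarrow> almost_complex_structure \<A> J \<and>
     (\<forall>c\<in>\<A>. \<forall>x\<in>chart_image c. \<forall>u v. nijenhuis (J c) x u v = 0)"

definition kahler_manifold ::
  "'m topology \<Rightarrow> ('m, 'e::euclidean_space) chart set \<Rightarrow>
   (('m, 'e) chart \<Rightarrow> 'e bilinear_field) \<Rightarrow> (('m, 'e) chart \<Rightarrow> 'e \<Rightarrow> 'e \<Rightarrow> 'e) \<Rightarrow> bool" where
  "kahler_manifold T \<A> g J \<longleftrightarrow>
     smooth_manifold T \<A> \<and> riemannian_metric \<A> g \<and> integrable_complex_structure \<A> J \<and>
     (\<forall>c\<in>\<A>. \<forall>x\<in>chart_image c.
        (\<forall>u v. g c x (J c x u) (J c x v) = g c x u v) \<and>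
        (\<forall>u v w. ext_deriv2 (kahler_form (g c) (J c)) x u v w = 0))"

definition kahler_ricci_soliton ::
  "('m, 'e::euclidean_space) chart set \<Rightarrow> (('m, 'e) chart \<Rightarrow> 'e bilinear_field) \<Rightarrow>
   ('m \<Rightarrow> real) \<Rightarrow> bool" where
  "kahler_ricci_soliton \<A> g f \<longleftrightarrow>
     (\<forall>c\<in>\<A>. \<forall>x\<in>chart_image c. \<forall>u v.
        Ric (g c) x u v - g c x u v
          = (1/2) * lie_derivative (grad (g c) (f \<circ> chart_inv c)) (g c) x u v)"

definition calabi_extremal ::
  "('m, 'e::euclidean_space) chart set \<Rightarrow> (('m, 'e) chart \<Rightarrow> 'e bilinear_field) \<Rightarrow>
   (('m, 'e) chart \<Rightarrow> 'e \<Rightarrow> 'e \<Rightarrow> 'e) \<Rightarrow> bool" where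
  "calabi_extremal \<A> g J \<longleftrightarrow>
     (\<forall>c\<in>\<A>. \<forall>x\<in>chart_image c. \<forall>u. dbar (J c) (del_sharp (g c) (J c) (scal (g c))) x u = 0)"

definition extremal_kahler_ricci_soliton ::
  "('m, 'e::euclidean_space) chart set \<Rightarrow> (('m, 'e) chart \<Rightarrow> 'e bilinear_field) \<Rightarrow>
   (('m, 'e) chart \<Rightarrow> 'e \<Rightarrow> 'e \<Rightarrow> 'e) \<Rightarrow> ('m \<Rightarrow> real) \<Rightarrow> bool" where
  "extremal_kahler_ricci_soliton \<A> g J f \<longleftrightarrow>
     kahler_ricci_soliton \<A> g f \<and> calabi_extremal \<A> g J"

definition positive_holomorphic_sectional_curvature ::
  "('m, 'e::euclidean_space) chart set \<Rightarrow> (('m, 'e) chart \<Rightarrow> 'e bilinear_field) \<Rightarrow>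
   (('m, 'e) chart \<Rightarrow> 'e \<Rightarrow> 'e \<Rightarrow> 'e) \<Rightarrow> bool" where
  "positive_holomorphic_sectional_curvature \<A> g J \<longleftrightarrow>
     (\<forall>c\<in>\<A>. \<forall>x\<in>chart_image c. \<forall>u. u \<noteq> 0 \<longrightarrow>
        g c x (Rm (g c) x u (J c x u) (J c x u)) u > 0)"

definition einstein ::
  "('m, 'e::euclidean_space) chart set \<Rightarrow> (('m, 'e) chart \<Rightarrow> 'e bilinear_field) \<Rightarrow> bool" where
  "einstein \<A> g \<longleftrightarrow>
     (\<exists>k::real. \<forall>c\<in>\<A>. \<forall>x\<in>chart_image c. \<forall>u v. Ric (g c) x u v = k * g c x u v)"

end

theory Submission
  imports Defs
begin

text \<open>
  Everything happens in the image of one chart. Let $X = \nabla f$ (\<open>soliton_field\<close>), let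
  $A u = \nabla_u X$ be the Hessian of $f$ as an endomorphism (\<open>hess\<close>), and let
  $B(u,v) = (\nabla_u A) v$ (\<open>nabla_hess\<close>). The soliton equation says
  $\mathrm{Ric} = g + g(A\,\cdot,\cdot)$. On a Kaehler manifold $\mathrm{Ric}$ is $J$-invariant, so
  $A$ commutes with $J$; since $J$ is parallel, $B(u,Jv) = J B(u,v)$. The Ricci identity for $X$ reads
  $B(u,v) - B(v,u) = R(u,v)X$.

  These two rules determine the gradient of the scalar curvature.
  They give $B(u,v) + B(Ju,Jv) = R(u,v)X + R(Ju,v)JX$. The trace over $v$ of $B(Ju,Jv)$ vanishes,
  because it is the trace of a symmetric endomorphism composed with the skew map $J$. As
  $s$ is the trace of $1 + A$, it follows that $ds(u) = \mathrm{tr}\,B(u,\cdot) = -2\,\mathrm{Ric}(u,X)$,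
  that is, $\nabla s = -2(X + AX)$.

  If $\nabla s$ is holomorphic, its covariant derivative commutes with $J$. The covariant derivative of
  $X + AX$ in direction $u$ is $Au + B(u,X) + A^2u$, so the only new information is
  $B(Ju,X) = J B(u,X)$. For $u = X$ this gives $B(JX,X) = J B(X,X) = B(X,JX)$, and the
  Ricci identity turns it into $R(X,JX)X = 0$. Hence the holomorphic sectional curvature in direction
  $X$ is zero, and positivity forces $X = 0$. Then $A = 0$ and $\mathrm{Ric} = g$ in every chart.

  The lemmas that carry the argument are \<open>nabla_hess_codazzi\<close>, \<open>nabla_hess_J\<close>,
  \<open>trace_nabla_hess\<close>, \<open>grad_scal\<close>, \<open>holomorphic_field\<close> and
  \<open>Rm_soliton_field\<close>. They rest on the classical facts that $J$ is parallel
  (\<open>J_parallel\<close>), that $\mathrm{Ric}$ is $J$-invariant (\<open>Ric_J\<close>) and that the curvature is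
  tensorial (\<open>ricci_identity\<close>). Since all these fields are differentiated,
  the argument also needs that second derivatives commute (\<open>dir_deriv_commute\<close>) and that raising
  an index with a smooth metric preserves smoothness (\<open>smooth_on_sharp\<close>).
\<close>

section \<open>Calculus of smooth functions\<close>

abbreviation dir_deriv ::
  "('a::euclidean_space \<Rightarrow> 'b::real_normed_vector) \<Rightarrow> 'a \<Rightarrow> 'a \<Rightarrow> 'b" where
  "dir_deriv f u x \<equiv> frechet_derivative f (at x) u"

lemma dir_deriv_eq: "(f has_derivative f') (at x) \<Longrightarrow> dir_deriv f u x = f' u"
  using frechet_derivative_at by metis

lemma has_derivative_dir_deriv:
  "f differentiable at x \<Longrightarrow> (f has_derivative (\<lambda>u. dir_deriv f u x)) (at x)"
  by (rule frechet_derivative_works[THEN iffD1])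

lemma dir_deriv_cong:
  assumes "open S" "x \<in> S" "\<And>y. y \<in> S \<Longrightarrow> f y = g y"
  shows "dir_deriv f u x = dir_deriv g u x"
proof -
  have "(f has_derivative d) (at x) \<longleftrightarrow> (g has_derivative d) (at x)" for d
    using has_derivative_transform_within_open[OF _ assms(1,2)] assms(3) by metis
  then show ?thesis
    by (simp add: frechet_derivative_def)
qed

lemma differentiable_cong_open:
  assumes "open S" "x \<in> S" "\<And>y. y \<in> S \<Longrightarrow> f y = g y" "f differentiable at x"
  shows "g differentiable at x"
  using assms has_derivative_transform_within_open unfolding differentiable_def by blast

lemma Ck_on_cong:
  assumes "open S" "\<And>y. y \<in> S \<Longrightarrow> f y = g y" "Ck_on k f S"
  shows "Ck_on k g S"
  using assms(2,3)
proof (induction k arbitrary: f g)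
  case 0
  then show ?case by (simp cong: continuous_on_cong)
next
  case (Suc k)
  have "g differentiable at x" if "x \<in> S" for x
    using differentiable_cong_open[OF assms(1) that] Suc.prems that by auto
  moreover have "Ck_on k (dir_deriv g v) S" for v
    by (rule Suc.IH[of "dir_deriv f v"])
      (use Suc.prems dir_deriv_cong[OF assms(1), of _ f g] in auto)
  ultimately show ?case by simp
qed

lemma Ck_on_pred: "Ck_on (Suc k) f S \<Longrightarrow> Ck_on k f S"
proof (induction k arbitrary: f)
  case 0
  then show ?case
    by (auto intro: continuous_at_imp_continuous_on differentiable_imp_continuous_within)
qed auto

lemma Ck_on_const: "Ck_on k (\<lambda>_. c) S"
  by (induction k arbitrary: c) auto

lemma Ck_on_add:
  assumes "open S" "Ck_on k f S" "Ck_on k g S"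
  shows "Ck_on k (\<lambda>x. f x + g x) S"
  using assms(2,3)
proof (induction k arbitrary: f g)
  case 0
  then show ?case by (simp add: continuous_on_add)
next
  case (Suc k)
  have "dir_deriv (\<lambda>x. f x + g x) v x = dir_deriv f v x + dir_deriv g v x" if "x \<in> S" for x v
    using Suc.prems that
    by (intro dir_deriv_eq has_derivative_add has_derivative_dir_deriv) auto
  then have "Ck_on k (dir_deriv (\<lambda>x. f x + g x) v) S" for v
    using Ck_on_cong[OF assms(1), of "\<lambda>x. dir_deriv f v x + dir_deriv g v x"] Suc by simp
  then show ?case using Suc.prems by auto
qed

lemma Ck_on_bilinear:
  fixes f :: "'e::euclidean_space \<Rightarrow> 'a::real_normed_vector"
    and g :: "'e \<Rightarrow> 'b::real_normed_vector"
  assumes bil: "bounded_bilinear bl" and "open S" "Ck_on k f S" "Ck_on k g S"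
  shows "Ck_on k (\<lambda>x. bl (f x) (g x)) S"
  using assms(3,4)
proof (induction k arbitrary: f g)
  case 0
  then show ?case by (simp add: bounded_bilinear.continuous_on[OF bil])
next
  case (Suc k)
  have "dir_deriv (\<lambda>x. bl (f x) (g x)) v x = bl (f x) (dir_deriv g v x) + bl (dir_deriv f v x) (g x)"
    if "x \<in> S" for x v
    using Suc.prems that
    by (intro dir_deriv_eq bounded_bilinear.FDERIV[OF bil] has_derivative_dir_deriv) auto
  moreover have "Ck_on k (\<lambda>x. bl (f x) (dir_deriv g v x) + bl (dir_deriv f v x) (g x)) S" for v
    using Suc.prems by (intro Ck_on_add assms(2) Suc.IH) (auto intro: Ck_on_pred)
  ultimately have "Ck_on k (dir_deriv (\<lambda>x. bl (f x) (g x)) v) S" for v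
    using Ck_on_cong[OF assms(2), of "\<lambda>x. bl (f x) (dir_deriv g v x) + bl (dir_deriv f v x) (g x)"]
    by simp
  moreover have "(\<lambda>x. bl (f x) (g x)) differentiable at x" if "x \<in> S" for x
    by (rule differentiableI, rule bounded_bilinear.FDERIV[OF bil];
        rule has_derivative_dir_deriv) (use Suc.prems that in auto)
  ultimately show ?case by simp
qed

lemma smooth_on_Ck: "smooth_on f S \<Longrightarrow> Ck_on k f S"
  by (simp add: smooth_on_def)

lemma smooth_on_differentiable: "smooth_on f S \<Longrightarrow> x \<in> S \<Longrightarrow> f differentiable at x"
  using smooth_on_Ck[of f S 1] by simp

lemma smooth_on_continuous: "smooth_on f S \<Longrightarrow> continuous_on S f"
  using smooth_on_Ck[of f S 0] by simp

lemma smooth_on_has_derivative: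
  "smooth_on f S \<Longrightarrow> x \<in> S \<Longrightarrow> (f has_derivative (\<lambda>u. dir_deriv f u x)) (at x)"
  by (simp add: has_derivative_dir_deriv smooth_on_differentiable)

lemma smooth_on_dir_deriv: "smooth_on f S \<Longrightarrow> smooth_on (dir_deriv f u) S"
  unfolding smooth_on_def using Ck_on.simps(2) by blast

lemma smooth_on_const: "smooth_on (\<lambda>_. c) S"
  by (simp add: smooth_on_def Ck_on_const)

lemma smooth_on_add:
  "open S \<Longrightarrow> smooth_on f S \<Longrightarrow> smooth_on g S \<Longrightarrow> smooth_on (\<lambda>x. f x + g x) S"
  by (simp add: smooth_on_def Ck_on_add)

lemma smooth_on_scaleR:
  "open S \<Longrightarrow> smooth_on f S \<Longrightarrow> smooth_on g S \<Longrightarrow> smooth_on (\<lambda>x. f x *\<^sub>R g x) S"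
  by (simp add: smooth_on_def Ck_on_bilinear[OF bounded_bilinear_scaleR])

lemma smooth_on_inner:
  "open S \<Longrightarrow> smooth_on f S \<Longrightarrow> smooth_on g S \<Longrightarrow> smooth_on (\<lambda>x. f x \<bullet> g x) S"
  by (simp add: smooth_on_def Ck_on_bilinear[OF bounded_bilinear_inner])

lemma smooth_on_diff:
  "open S \<Longrightarrow> smooth_on f S \<Longrightarrow> smooth_on g S \<Longrightarrow> smooth_on (\<lambda>x. f x - g x) S"
  using smooth_on_add[OF _ _ smooth_on_scaleR[OF _ smooth_on_const[of "-1"]], of S f g] by simp

lemma Ck_on_sum:
  assumes "open S" "\<And>i. i \<in> I \<Longrightarrow> Ck_on k (f i) S"
  shows "Ck_on k (\<lambda>x. \<Sum>i\<in>I. f i x) S"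
  using assms(2)
  by (induction I rule: infinite_finite_induct) (auto intro: Ck_on_const Ck_on_add[OF assms(1)])

lemma dir_deriv_add:
  "f differentiable at x \<Longrightarrow> g differentiable at x \<Longrightarrow>
   dir_deriv (\<lambda>x. f x + g x) u x = dir_deriv f u x + dir_deriv g u x"
  by (intro dir_deriv_eq has_derivative_add has_derivative_dir_deriv)

lemma dir_deriv_scaleR:
  "f differentiable at x \<Longrightarrow>
   dir_deriv (\<lambda>x. c *\<^sub>R f x) u x = c *\<^sub>R dir_deriv f u x"
  by (intro dir_deriv_eq has_derivative_scaleR_right has_derivative_dir_deriv)

lemma dir_deriv_linear: "f differentiable at x \<Longrightarrow> linear (\<lambda>u. dir_deriv f u x)"
  by (rule linear_frechet_derivative)

lemma dir_deriv_inner: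
  "f differentiable at x \<Longrightarrow> dir_deriv (\<lambda>y. f y \<bullet> b) u x = dir_deriv f u x \<bullet> b"
  by (intro dir_deriv_eq has_derivative_inner_left has_derivative_dir_deriv)

text \<open>Two applications of the mean value theorem, first along \<open>u\<close> and then along \<open>v\<close>, express the second
  difference over a parallelogram by a second derivative at an interior point. The second difference is
  symmetric in \<open>u\<close> and \<open>v\<close>, which is why second derivatives commute.\<close>

lemma second_difference_mvt:
  fixes \<phi> :: "'a::euclidean_space \<Rightarrow> real"
  assumes "smooth_on \<phi> S" "0 < h"
    and in_S: "\<And>s t. 0 \<le> s \<Longrightarrow> s \<le> h \<Longrightarrow> 0 \<le> t \<Longrightarrow> t \<le> h \<Longrightarrow> x + s *\<^sub>R u + t *\<^sub>R v \<in> S"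
  shows "\<exists>s t. 0 < s \<and> s < h \<and> 0 < t \<and> t < h \<and>
    \<phi> (x + h *\<^sub>R u + h *\<^sub>R v) - \<phi> (x + h *\<^sub>R u) - \<phi> (x + h *\<^sub>R v) + \<phi> x
      = h * (h * dir_deriv (dir_deriv \<phi> u) v (x + s *\<^sub>R u + t *\<^sub>R v))"
proof -
  have D\<phi>: "(\<phi> has_derivative (\<lambda>w. dir_deriv \<phi> w y)) (at y)" if "y \<in> S" for y
    using that assms(1) smooth_on_has_derivative by blast
  have DD\<phi>: "(dir_deriv \<phi> u has_derivative (\<lambda>w. dir_deriv (dir_deriv \<phi> u) w y)) (at y)"
    if "y \<in> S" for y
    using that assms(1) smooth_on_has_derivative smooth_on_dir_deriv by blast
  have lin: "dir_deriv \<phi> (k *\<^sub>R w) y = k * dir_deriv \<phi> w y" 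
     "dir_deriv (dir_deriv \<phi> u) (k *\<^sub>R w) y = k * dir_deriv (dir_deriv \<phi> u) w y" if "y \<in> S" for y k w
    using dir_deriv_linear[of _ y] that assms(1) smooth_on_differentiable smooth_on_dir_deriv
    by (metis linear_scale real_scaleR_def)+
  define \<psi> where "\<psi> s = \<phi> (x + s *\<^sub>R u + h *\<^sub>R v) - \<phi> (x + s *\<^sub>R u)" for s
  define \<psi>' where "\<psi>' s = dir_deriv \<phi> u (x + s *\<^sub>R u + h *\<^sub>R v) - dir_deriv \<phi> u (x + s *\<^sub>R u)" for s
  have "(\<psi> has_derivative (\<lambda>k. k * \<psi>' s)) (at s)" if "0 \<le> s" "s \<le> h" for s
  proof -
    have S: "x + s *\<^sub>R u + h *\<^sub>R v \<in> S" "x + s *\<^sub>R u \<in> S"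
      using in_S[of s h] in_S[of s 0] that assms(2) by auto
    have "((\<lambda>s. \<phi> (x + s *\<^sub>R u + h *\<^sub>R v)) has_derivative
        (\<lambda>k. dir_deriv \<phi> (k *\<^sub>R u) (x + s *\<^sub>R u + h *\<^sub>R v))) (at s)"
      by (rule has_derivative_compose[where f = "\<lambda>s. x + s *\<^sub>R u + h *\<^sub>R v", OF _ D\<phi>[OF S(1)]]) (auto intro!: derivative_eq_intros)
    moreover have "((\<lambda>s. \<phi> (x + s *\<^sub>R u)) has_derivative
        (\<lambda>k. dir_deriv \<phi> (k *\<^sub>R u) (x + s *\<^sub>R u))) (at s)"
      by (rule has_derivative_compose[where f = "\<lambda>s. x + s *\<^sub>R u", OF _ D\<phi>[OF S(2)]]) (auto intro!: derivative_eq_intros)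
    ultimately have "(\<psi> has_derivative (\<lambda>k. dir_deriv \<phi> (k *\<^sub>R u) (x + s *\<^sub>R u + h *\<^sub>R v)
       - dir_deriv \<phi> (k *\<^sub>R u) (x + s *\<^sub>R u))) (at s)"
      unfolding \<psi>_def by (rule has_derivative_diff)
    then show ?thesis
      by (simp add: lin S \<psi>'_def right_diff_distrib)
  qed
  then have "\<exists>s\<in>{0<..<h}. \<psi> h - \<psi> 0 = (h - 0) * \<psi>' s"
    using assms(2) by (intro mvt_simple) (auto intro: has_derivative_at_withinI)
  then obtain s where s: "0 < s" "s < h" "\<psi> h - \<psi> 0 = h * \<psi>' s" by auto
  define \<theta> where "\<theta> t = dir_deriv \<phi> u (x + s *\<^sub>R u + t *\<^sub>R v)" for t
  define \<theta>' where "\<theta>' t = dir_deriv (dir_deriv \<phi> u) v (x + s *\<^sub>R u + t *\<^sub>R v)" for t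
  have "(\<theta> has_derivative (\<lambda>k. k * \<theta>' t)) (at t)" if "0 \<le> t" "t \<le> h" for t
  proof -
    have S: "x + s *\<^sub>R u + t *\<^sub>R v \<in> S"
      using in_S[of s t] that s by auto
    have "(\<theta> has_derivative
        (\<lambda>k. dir_deriv (dir_deriv \<phi> u) (k *\<^sub>R v) (x + s *\<^sub>R u + t *\<^sub>R v))) (at t)"
      unfolding \<theta>_def
      by (rule has_derivative_compose[where f = "\<lambda>t. x + s *\<^sub>R u + t *\<^sub>R v", OF _ DD\<phi>[OF S]]) (auto intro!: derivative_eq_intros)
    then show ?thesis
      by (simp add: lin S \<theta>'_def)
  qed
  then have "\<exists>t\<in>{0<..<h}. \<theta> h - \<theta> 0 = (h - 0) * \<theta>' t"
    using assms(2) by (intro mvt_simple) (auto intro: has_derivative_at_withinI)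
  then obtain t where t: "0 < t" "t < h" "\<theta> h - \<theta> 0 = h * \<theta>' t" by auto
  have "\<psi>' s = h * \<theta>' t"
    using t(3) by (simp add: \<psi>'_def \<theta>_def)
  then have "\<psi> h - \<psi> 0 = h * (h * \<theta>' t)" using s(3) by simp
  then show ?thesis
    using s t by (intro exI[of _ s] exI[of _ t]) (simp add: \<psi>_def \<theta>'_def algebra_simps)
qed

lemma dir_deriv_commute_real:
  fixes \<phi> :: "'a::euclidean_space \<Rightarrow> real"
  assumes "smooth_on \<phi> S" "open S" "x \<in> S"
  shows "dir_deriv (dir_deriv \<phi> u) v x = dir_deriv (dir_deriv \<phi> v) u x"
proof (rule ccontr)
  define F where "F y = dir_deriv (dir_deriv \<phi> u) v y" for y
  define H where "H y = dir_deriv (dir_deriv \<phi> v) u y" for y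
  assume "\<not> ?thesis"
  then have ne: "F x \<noteq> H x" by (simp add: F_def H_def)
  define e where "e = \<bar>F x - H x\<bar> / 2"
  have e: "e > 0" using ne by (simp add: e_def)
  have "isCont F x" "isCont H x"
    using assms smooth_on_continuous[OF smooth_on_dir_deriv[OF smooth_on_dir_deriv[OF assms(1)]]]
    by (simp_all add: F_def[abs_def] H_def[abs_def] continuous_on_eq_continuous_at)
  then obtain d1 d2 where d1: "d1 > 0" "\<And>y. dist y x < d1 \<Longrightarrow> dist (F y) (F x) < e"
     and d2: "d2 > 0" "\<And>y. dist y x < d2 \<Longrightarrow> dist (H y) (H x) < e"
    using e unfolding continuous_at by (metis LIM_def dist_self)
  obtain d3 where d3: "d3 > 0" "ball x d3 \<subseteq> S"
    using assms(2,3) openE by blast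
  define d where "d = min d1 (min d2 d3)"
  have d: "d > 0" using d1 d2 d3 by (simp add: d_def)
  define N where "N = norm u + norm v + 1"
  have N: "N > 0" by (simp add: N_def add_nonneg_pos)
  define h where "h = d / (2 * N)"
  have h: "h > 0" and hd: "h * N < d" using d N by (simp_all add: h_def)
  have close: "norm (s *\<^sub>R u + t *\<^sub>R v) < d" if "0 \<le> s" "s \<le> h" "0 \<le> t" "t \<le> h" for s t
  proof -
    have "norm (s *\<^sub>R u + t *\<^sub>R v) \<le> s * norm u + t * norm v"
      using norm_triangle_ineq[of "s *\<^sub>R u" "t *\<^sub>R v"] that by simp
    also have "\<dots> \<le> h * norm u + h * norm v"
      using that by (intro add_mono mult_right_mono) auto
    also have "\<dots> < d" using hd h by (simp add: N_def algebra_simps)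
    finally show ?thesis .
  qed
  have dist: "dist (x + s *\<^sub>R u + t *\<^sub>R v) x < d" "dist (x + t *\<^sub>R v + s *\<^sub>R u) x < d"
    if "0 \<le> s" "s \<le> h" "0 \<le> t" "t \<le> h" for s t
    using close[OF that] by (simp_all add: dist_norm add.assoc add.commute)
  have in_S: "x + s *\<^sub>R u + t *\<^sub>R v \<in> S" "x + t *\<^sub>R v + s *\<^sub>R u \<in> S"
    if "0 \<le> s" "s \<le> h" "0 \<le> t" "t \<le> h" for s t
    using dist[OF that] d3 by (auto simp: d_def dist_commute subset_iff)
  obtain s t where st: "0 < s" "s < h" "0 < t" "t < h"
    "\<phi> (x + h *\<^sub>R u + h *\<^sub>R v) - \<phi> (x + h *\<^sub>R u) - \<phi> (x + h *\<^sub>R v) + \<phi> x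
      = h * (h * F (x + s *\<^sub>R u + t *\<^sub>R v))"
    using second_difference_mvt[OF assms(1) h, of x u v] in_S unfolding F_def by blast
  obtain s' t' where st': "0 < s'" "s' < h" "0 < t'" "t' < h"
    "\<phi> (x + h *\<^sub>R v + h *\<^sub>R u) - \<phi> (x + h *\<^sub>R v) - \<phi> (x + h *\<^sub>R u) + \<phi> x
      = h * (h * H (x + s' *\<^sub>R v + t' *\<^sub>R u))"
    using second_difference_mvt[OF assms(1) h, of x v u] in_S unfolding H_def by blast
  \<comment> \<open>Both sides are the same second difference over one small parallelogram.\<close>
  have "h * (h * F (x + s *\<^sub>R u + t *\<^sub>R v)) = h * (h * H (x + s' *\<^sub>R v + t' *\<^sub>R u))"
    unfolding st(5)[symmetric] st'(5)[symmetric] by (simp add: algebra_simps)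
  then have "F (x + s *\<^sub>R u + t *\<^sub>R v) = H (x + s' *\<^sub>R v + t' *\<^sub>R u)" using h by simp
  moreover have "dist (F (x + s *\<^sub>R u + t *\<^sub>R v)) (F x) < e"
    using dist(1)[of s t] st by (intro d1) (auto simp: d_def)
  moreover have "dist (H (x + s' *\<^sub>R v + t' *\<^sub>R u)) (H x) < e"
    using dist(2)[of t' s'] st' by (intro d2) (auto simp: d_def)
  ultimately have "\<bar>F x - H x\<bar> < e + e" by (simp add: dist_real_def)
  then show False by (simp add: e_def)
qed

lemma dir_deriv_commute:
  fixes \<phi> :: "'a::euclidean_space \<Rightarrow> 'b::euclidean_space"
  assumes "smooth_on \<phi> S" "open S" "x \<in> S"
  shows "dir_deriv (dir_deriv \<phi> u) v x = dir_deriv (dir_deriv \<phi> v) u x"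
proof (rule euclidean_eqI)
  fix b :: 'b
  have sm: "smooth_on (\<lambda>y. \<phi> y \<bullet> b) S"
    by (intro smooth_on_inner smooth_on_const assms)
  have "dir_deriv (dir_deriv \<phi> u) v x \<bullet> b = dir_deriv (dir_deriv (\<lambda>y. \<phi> y \<bullet> b) u) v x" for u v
  proof -
    have "dir_deriv (dir_deriv \<phi> u) v x \<bullet> b = dir_deriv (\<lambda>y. dir_deriv \<phi> u y \<bullet> b) v x"
      by (intro dir_deriv_inner[symmetric] smooth_on_differentiable[OF smooth_on_dir_deriv, of _ S] assms)
    also have "\<dots> = dir_deriv (dir_deriv (\<lambda>y. \<phi> y \<bullet> b) u) v x"
      by (rule dir_deriv_cong[OF assms(2,3)])
        (simp add: dir_deriv_inner smooth_on_differentiable[OF assms(1)])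
    finally show ?thesis .
  qed
  then show "dir_deriv (dir_deriv \<phi> u) v x \<bullet> b = dir_deriv (dir_deriv \<phi> v) u x \<bullet> b"
    using dir_deriv_commute_real[OF sm assms(2,3)] by simp
qed

section \<open>Smooth families of linear maps\<close>

text \<open>Endomorphism fields, metrics with one slot fixed and Christoffel symbols are all smooth families of
  linear maps. Since a family is differentiated with its argument held constant, inserting a
  variable vector field produces the Leibniz rule \<open>dir_deriv_family\<close>.\<close>

definition smooth_linear_on ::
  "'e::euclidean_space set \<Rightarrow> ('e \<Rightarrow> 'a::euclidean_space \<Rightarrow> 'b::real_normed_vector) \<Rightarrow> bool" where
  "smooth_linear_on S L \<longleftrightarrow> (\<forall>x\<in>S. linear (L x)) \<and> (\<forall>v. smooth_on (\<lambda>x. L x v) S)"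

lemma linear_expand: "linear f \<Longrightarrow> f v = (\<Sum>b\<in>Basis. (v \<bullet> b) *\<^sub>R f b)"
  using linear_sum[of f "\<lambda>b. (v \<bullet> b) *\<^sub>R b" Basis] euclidean_representation[of v]
  by (simp add: linear_scale)

lemma Ck_on_family_apply:
  fixes L :: "'e::euclidean_space \<Rightarrow> 'a::euclidean_space \<Rightarrow> 'b::real_normed_vector"
  assumes "open S" "\<And>x. x \<in> S \<Longrightarrow> linear (L x)" "\<And>v. Ck_on k (\<lambda>x. L x v) S" "Ck_on k V S"
  shows "Ck_on k (\<lambda>x. L x (V x)) S"
proof (rule Ck_on_cong[OF assms(1)])
  show "Ck_on k (\<lambda>x. \<Sum>b\<in>Basis. (V x \<bullet> b) *\<^sub>R L x b) S"
    by (intro Ck_on_sum Ck_on_bilinear[OF bounded_bilinear_scaleR]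
        Ck_on_bilinear[OF bounded_bilinear_inner] Ck_on_const assms)
  show "(\<Sum>b\<in>Basis. (V y \<bullet> b) *\<^sub>R L y b) = L y (V y)" if "y \<in> S" for y
    using linear_expand[OF assms(2)[OF that], of "V y"] by simp
qed

lemma smooth_on_family_apply:
  "open S \<Longrightarrow> smooth_linear_on S L \<Longrightarrow> smooth_on V S \<Longrightarrow> smooth_on (\<lambda>x. L x (V x)) S"
  unfolding smooth_linear_on_def smooth_on_def using Ck_on_family_apply by blast

lemma family_has_derivative:
  fixes L :: "'e::euclidean_space \<Rightarrow> 'a::euclidean_space \<Rightarrow> 'b::real_normed_vector"
  assumes "open S" "x \<in> S" "\<And>y. y \<in> S \<Longrightarrow> linear (L y)"
    and "\<And>v. (\<lambda>y. L y v) differentiable at x" and "V differentiable at x"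
  shows "((\<lambda>y. L y (V y)) has_derivative
      (\<lambda>u. dir_deriv (\<lambda>y. L y (V x)) u x + L x (dir_deriv V u x))) (at x)"
proof -
  \<comment> \<open>In coordinates the family is a finite sum of products of scalar and vector functions.\<close>
  have D: "((\<lambda>y. \<Sum>b\<in>Basis. (W y \<bullet> b) *\<^sub>R L y b) has_derivative
      (\<lambda>u. \<Sum>b\<in>Basis. (W x \<bullet> b) *\<^sub>R dir_deriv (\<lambda>y. L y b) u x + (dir_deriv W u x \<bullet> b) *\<^sub>R L x b)) (at x)"
    if "W differentiable at x" for W
    using that assms(4)
    by (intro has_derivative_sum has_derivative_scaleR has_derivative_inner_left has_derivative_dir_deriv)
  have D': "((\<lambda>y. L y (W y)) has_derivative
      (\<lambda>u. \<Sum>b\<in>Basis. (W x \<bullet> b) *\<^sub>R dir_deriv (\<lambda>y. L y b) u x + (dir_deriv W u x \<bullet> b) *\<^sub>R L x b)) (at x)"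
    if "W differentiable at x" for W
    by (rule has_derivative_transform_within_open[OF D[OF that] assms(1,2)])
      (simp add: linear_expand[OF assms(3), symmetric])
  have c: "dir_deriv (\<lambda>y. L y (V x)) u x = (\<Sum>b\<in>Basis. (V x \<bullet> b) *\<^sub>R dir_deriv (\<lambda>y. L y b) u x)" for u
    using dir_deriv_eq[OF D'[of "\<lambda>_. V x"]] by simp
  show ?thesis
    using D'[OF assms(5)] by (simp add: sum.distrib c linear_expand[OF assms(3)[OF assms(2)], symmetric])
qed

lemma dir_deriv_family:
  assumes "open S" "smooth_linear_on S L" "smooth_on V S" "x \<in> S"
  shows "dir_deriv (\<lambda>y. L y (V y)) u x = dir_deriv (\<lambda>y. L y (V x)) u x + L x (dir_deriv V u x)"
  by (rule dir_deriv_eq, rule family_has_derivative)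
    (use assms in \<open>auto simp: smooth_linear_on_def intro: smooth_on_differentiable\<close>)

lemma smooth_linear_on_dir_deriv:
  assumes "open S" "smooth_linear_on S L"
  shows "smooth_linear_on S (\<lambda>x v. dir_deriv (\<lambda>y. L y v) u x)"
  unfolding smooth_linear_on_def
proof (intro conjI allI ballI)
  fix x assume x: "x \<in> S"
  have d: "(\<lambda>y. L y v) differentiable at x" for v
    using assms x by (auto simp: smooth_linear_on_def intro: smooth_on_differentiable)
  have l: "linear (L y)" if "y \<in> S" for y
    using assms that by (simp add: smooth_linear_on_def)
  show "linear (\<lambda>v. dir_deriv (\<lambda>y. L y v) u x)"
  proof (rule linearI)
    fix v w :: 'b and c :: real
    have "dir_deriv (\<lambda>y. L y (v + w)) u x = dir_deriv (\<lambda>y. L y v + L y w) u x"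
      by (rule dir_deriv_cong[OF assms(1) x]) (simp add: l linear_add)
    then show "dir_deriv (\<lambda>y. L y (v + w)) u x = dir_deriv (\<lambda>y. L y v) u x + dir_deriv (\<lambda>y. L y w) u x"
      by (simp add: dir_deriv_add d)
    have "dir_deriv (\<lambda>y. L y (c *\<^sub>R v)) u x = dir_deriv (\<lambda>y. c *\<^sub>R L y v) u x"
      by (rule dir_deriv_cong[OF assms(1) x]) (simp add: l linear_scale)
    then show "dir_deriv (\<lambda>y. L y (c *\<^sub>R v)) u x = c *\<^sub>R dir_deriv (\<lambda>y. L y v) u x"
      by (simp add: dir_deriv_scaleR d)
  qed
next
  show "smooth_on (dir_deriv (\<lambda>y. L y v) u) S" for v
    using assms by (simp add: smooth_linear_on_def smooth_on_dir_deriv)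
qed

section \<open>Inner products and traces\<close>

definition inner_product_form :: "('e::euclidean_space \<Rightarrow> 'e \<Rightarrow> real) \<Rightarrow> bool" where
  "inner_product_form B \<longleftrightarrow>
     bilinear B \<and> (\<forall>u v. B u v = B v u) \<and> (\<forall>u. u \<noteq> 0 \<longrightarrow> B u u > 0)"

text \<open>The vector that represents \<open>B u\<close> in the Euclidean inner product; \<open>flat B\<close> is the matrix of \<open>B\<close>.\<close>

definition flat :: "('e::euclidean_space \<Rightarrow> 'e \<Rightarrow> real) \<Rightarrow> 'e \<Rightarrow> 'e" where
  "flat B u = (\<Sum>b\<in>Basis. B u b *\<^sub>R b)"

lemma inner_product_form_linear:
  assumes "inner_product_form B"
  shows "linear (B u)" "linear (\<lambda>v. B v u)"
  using assms by (auto simp: inner_product_form_def bilinear_def)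

lemma flat_inner:
  assumes "inner_product_form B"
  shows "flat B u \<bullet> v = B u v"
  using linear_expand[OF inner_product_form_linear(1)[OF assms], of u v]
  by (simp add: flat_def inner_sum_left mult.commute inner_commute[of v])

lemma inner_product_form_eq_0:
  "inner_product_form B \<Longrightarrow> (\<And>w. B v w = 0) \<Longrightarrow> v = 0"
  unfolding inner_product_form_def by (metis less_irrefl)

lemma inner_product_form_eqI:
  assumes "inner_product_form B" "\<And>w. B u w = B v w"
  shows "u = v"
proof -
  have "B (u - v) w = 0" for w
    using linear_diff[OF inner_product_form_linear(2)[OF assms(1)], of u v w] assms(2) by simp
  then show ?thesis
    using inner_product_form_eq_0[OF assms(1)] by (metis eq_iff_diff_eq_0)
qed

lemma linear_flat:
  assumes "inner_product_form B"
  shows "linear (flat B)"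
proof -
  have "bilinear B" using assms by (simp add: inner_product_form_def)
  then show ?thesis
    unfolding linear_iff vector_eq_rdot[symmetric, where 'a = 'a]
    by (simp add: flat_inner[OF assms] inner_add_left bilinear_ladd bilinear_lmul)
qed

lemma inj_flat: "inner_product_form B \<Longrightarrow> inj (flat B)"
  by (rule injI, rule inner_product_form_eqI, assumption)
    (metis flat_inner)

lemma sharp_unique_exists:
  assumes "inner_product_form (G x)" "linear \<alpha>"
  shows "\<exists>!v. \<forall>w. G x v w = \<alpha> w"
proof -
  have "surj (flat (G x))"
    using linear_flat inj_flat assms(1) linear_injective_imp_surjective by blast
  then obtain v where v: "flat (G x) v = (\<Sum>b\<in>Basis. \<alpha> b *\<^sub>R b)" by (metis surjD)
  have "G x v w = \<alpha> w" for w
    unfolding flat_inner[OF assms(1), symmetric] v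
    using linear_expand[OF assms(2), of w]
    by (simp add: inner_sum_left mult.commute inner_commute[of w])
  then show ?thesis
    using inner_product_form_eqI[OF assms(1)] by (intro ex1I[of _ v]) auto
qed

lemma sharp_works:
  assumes "inner_product_form (G x)" "linear \<alpha>"
  shows "G x (sharp G x \<alpha>) w = \<alpha> w"
  using theI'[OF sharp_unique_exists[of G x \<alpha>]] assms unfolding sharp_def by blast

lemma sharp_eqI:
  assumes "inner_product_form (G x)" "\<And>w. G x v w = \<alpha> w"
  shows "sharp G x \<alpha> = v"
  unfolding sharp_def using assms inner_product_form_eqI[OF assms(1)]
  by (intro the_equality) auto

lemma endo_trace_add: "endo_trace (\<lambda>v. A v + B v) = endo_trace A + endo_trace B"
  by (simp add: endo_trace_def inner_add_left sum.distrib)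

lemma endo_trace_diff: "endo_trace (\<lambda>v. A v - B v) = endo_trace A - endo_trace B"
  by (simp add: endo_trace_def inner_diff_left sum_subtractf)

lemma endo_trace_minus: "endo_trace (\<lambda>v. - A v) = - endo_trace A"
  by (simp add: endo_trace_def sum_negf)

lemma endo_trace_commute:
  assumes "linear A" "linear B"
  shows "endo_trace (\<lambda>v. A (B v)) = endo_trace (\<lambda>v. B (A v))"
proof -
  have "endo_trace (\<lambda>v. A (B v)) = (\<Sum>b\<in>Basis. \<Sum>c\<in>Basis. (B b \<bullet> c) * (A c \<bullet> b))"
    unfolding endo_trace_def by (subst linear_expand[OF assms(1)]) (simp add: inner_sum_left)
  moreover have "endo_trace (\<lambda>v. B (A v)) = (\<Sum>c\<in>Basis. \<Sum>b\<in>Basis. (A c \<bullet> b) * (B b \<bullet> c))"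
    unfolding endo_trace_def by (subst linear_expand[OF assms(2)]) (simp add: inner_sum_left)
  ultimately show ?thesis
    using sum.swap[of "\<lambda>b c. (B b \<bullet> c) * (A c \<bullet> b)" Basis Basis] by (simp add: mult.commute)
qed

text \<open>With $L$ the matrix of the form, skewness reads $L C = - C^* L$, so $C = - L^{-1} C^* L$ has the same
  trace as $-C^*$, that is, as $-C$.\<close>

lemma endo_trace_skew:
  fixes C :: "'e::euclidean_space \<Rightarrow> 'e"
  assumes B: "inner_product_form B" and C: "linear C" and skew: "\<And>u v. B (C u) v = - B u (C v)"
  shows "endo_trace C = 0"
proof -
  obtain K where K: "linear K" "\<And>v. K (flat B v) = v"
    using linear_injective_left_inverse[OF linear_flat[OF B] inj_flat[OF B]] by (auto simp: fun_eq_iff)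
  have "surj (flat B)"
    using linear_flat inj_flat B linear_injective_imp_surjective by blast
  then have FK: "flat B (K v) = v" for v
    using K(2) by (metis surjD)
  have adj: "adjoint C u \<bullet> v = u \<bullet> C v" for u v
    using adjoint_works[OF C, of v u] by (simp add: inner_commute)
  have "flat B (C u) = - adjoint C (flat B u)" for u
    by (rule vector_eq_rdot[THEN iffD1])
      (simp add: adj flat_inner[OF B] skew)
  then have "C u = - K (adjoint C (flat B u))" for u
    using K by (metis linear_neg)
  then have "C = (\<lambda>u. - K (adjoint C (flat B u)))" by blast
  then have "endo_trace C = - endo_trace (\<lambda>u. K (adjoint C (flat B u)))"
    using endo_trace_minus[of "\<lambda>u. K (adjoint C (flat B u))"] by simp
  also have "endo_trace (\<lambda>u. K (adjoint C (flat B u))) = endo_trace (\<lambda>u. adjoint C (flat B (K u)))"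
    by (rule endo_trace_commute[OF K(1)])
      (use linear_compose[OF linear_flat[OF B] adjoint_linear[OF C]] in \<open>simp add: o_def\<close>)
  also have "\<dots> = endo_trace C"
    unfolding FK endo_trace_def adj by (simp add: inner_commute)
  finally show ?thesis by simp
qed

section \<open>Raising an index smoothly\<close>

lemma bilinear_form_bound:
  fixes B :: "'e::euclidean_space \<Rightarrow> 'e \<Rightarrow> real"
  assumes "bilinear B"
  shows "\<bar>B v w\<bar> \<le> (\<Sum>a\<in>Basis. \<Sum>b\<in>Basis. \<bar>B a b\<bar>) * (norm v * norm w)"
proof -
  have "B v w = (\<Sum>a\<in>Basis. \<Sum>b\<in>Basis. (v \<bullet> a) * ((w \<bullet> b) * B a b))"
  proof -
    have l: "linear (\<lambda>v. B v w)" "linear (B a)" for a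
      using assms by (auto simp: bilinear_def)
    show ?thesis
      unfolding linear_expand[OF l(1), of v]
      by (rule sum.cong[OF refl], subst linear_expand[OF l(2)]) (simp add: sum_distrib_left)
  qed
  also have "\<bar>\<dots>\<bar> \<le> (\<Sum>a\<in>Basis. \<Sum>b\<in>Basis. \<bar>(v \<bullet> a) * ((w \<bullet> b) * B a b)\<bar>)"
    by (intro order.trans[OF sum_abs] sum_mono sum_abs)
  also have "\<dots> \<le> (\<Sum>a\<in>Basis. \<Sum>b\<in>Basis. \<bar>B a b\<bar> * (norm v * norm w))"
  proof (intro sum_mono)
    fix a b :: 'e assume ab: "a \<in> Basis" "b \<in> Basis"
    have "\<bar>v \<bullet> a\<bar> * \<bar>w \<bullet> b\<bar> \<le> norm v * norm w"
      using ab by (intro mult_mono Basis_le_norm) auto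
    then show "\<bar>(v \<bullet> a) * ((w \<bullet> b) * B a b)\<bar> \<le> \<bar>B a b\<bar> * (norm v * norm w)"
      using mult_left_mono[of "\<bar>v \<bullet> a\<bar> * \<bar>w \<bullet> b\<bar>" "norm v * norm w" "\<bar>B a b\<bar>"]
      by (simp add: abs_mult ac_simps)
  qed
  finally show ?thesis by (simp add: sum_distrib_right)
qed

lemma inner_product_form_coercive:
  assumes "inner_product_form (B :: 'e::euclidean_space \<Rightarrow> 'e \<Rightarrow> real)"
  obtains c where "c > 0" "\<And>v. c * (norm v)\<^sup>2 \<le> B v v"
proof -
  have bl: "bilinear B" using assms by (simp add: inner_product_form_def)
  have cont: "continuous_on (sphere 0 1) (\<lambda>v. B v v)"
    using bilinear_continuous_on_compose[OF continuous_on_id continuous_on_id bl] by simp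
  have "\<exists>u\<in>sphere 0 1. \<forall>v\<in>sphere 0 1. B u u \<le> B v v"
    by (rule continuous_attains_inf[OF _ _ cont]) auto
  then obtain u where u: "norm u = 1" "\<And>v. norm v = 1 \<Longrightarrow> B u u \<le> B v v" by auto
  show thesis
  proof (rule that[of "B u u"])
    have "u \<noteq> 0" using u(1) by auto
    then show "B u u > 0" using assms by (auto simp: inner_product_form_def)
    show "B u u * (norm v)\<^sup>2 \<le> B v v" for v
    proof (cases "v = 0")
      case True
      then show ?thesis by (simp add: bilinear_lzero[OF bl])
    next
      case False
      have "B u u \<le> B (v /\<^sub>R norm v) (v /\<^sub>R norm v)" using False by (intro u) simp
      also have "\<dots> = B v v / (norm v)\<^sup>2"
        by (simp add: bilinear_lmul[OF bl] bilinear_rmul[OF bl] power2_eq_square field_simps)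
      finally show ?thesis using False by (simp add: field_simps)
    qed
  qed
qed

text \<open>One coercivity constant serves in a whole neighbourhood, because the entries of the form vary
  continuously; this bounds the inverse matrices uniformly.\<close>

lemma coercive_near:
  fixes G :: "'e::euclidean_space bilinear_field"
  assumes "open S" "x0 \<in> S" and met: "\<And>x. x \<in> S \<Longrightarrow> inner_product_form (G x)"
    and cont: "\<And>u v. continuous_on S (\<lambda>x. G x u v)"
  obtains c where "c > 0" "\<forall>\<^sub>F x in at x0. x \<in> S \<and> (\<forall>v. c * (norm v)\<^sup>2 \<le> G x v v)"
proof -
  obtain c where c: "c > 0" "\<And>v. c * (norm v)\<^sup>2 \<le> G x0 v v"
    using inner_product_form_coercive[OF met[OF assms(2)]] by blast
  define E where "E x = (\<Sum>a\<in>Basis. \<Sum>b\<in>Basis. \<bar>G x a b - G x0 a b\<bar>)" for x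
  have "continuous_on S E"
    unfolding E_def by (intro continuous_intros cont)
  then have "(E \<longlongrightarrow> E x0) (at x0)"
    using assms(1,2) by (simp add: continuous_on_eq_continuous_at isCont_def)
  then have "\<forall>\<^sub>F x in at x0. E x < c / 2"
    using c by (intro order_tendstoD(2)[of E "E x0"]) (auto simp: E_def)
  moreover have "\<forall>\<^sub>F x in at x0. x \<in> S"
    using assms(1,2) eventually_at_in_open' by blast
  ultimately have "\<forall>\<^sub>F x in at x0. x \<in> S \<and> (\<forall>v. c / 2 * (norm v)\<^sup>2 \<le> G x v v)"
  proof eventually_elim
    case (elim x)
    have bl: "bilinear (\<lambda>u v. G x u v - G x0 u v)"
      using met[OF elim(2)] met[OF assms(2)]
      by (auto simp: inner_product_form_def bilinear_def intro!: linear_compose_sub)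
    have "c / 2 * (norm v)\<^sup>2 \<le> G x v v" for v
    proof -
      have "\<bar>G x v v - G x0 v v\<bar> \<le> E x * (norm v)\<^sup>2"
        using bilinear_form_bound[OF bl, of v v] by (simp add: E_def power2_eq_square)
      also have "\<dots> \<le> c / 2 * (norm v)\<^sup>2"
        using elim(1) by (intro mult_right_mono) auto
      finally have "\<bar>G x v v - G x0 v v\<bar> \<le> c / 2 * (norm v)\<^sup>2" .
      then show ?thesis using c(2)[of v] by linarith
    qed
    then show ?case using elim by blast
  qed
  then show thesis using that[of "c / 2"] c by simp
qed

lemma continuous_at_sharp:
  fixes G :: "'e::euclidean_space bilinear_field"
  assumes "open S" "x0 \<in> S" and met: "\<And>x. x \<in> S \<Longrightarrow> inner_product_form (G x)"
    and cont: "\<And>u v. continuous_on S (\<lambda>x. G x u v)"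
    and lin: "\<And>x. x \<in> S \<Longrightarrow> linear (\<alpha> x)" and cont\<alpha>: "\<And>w. continuous_on S (\<lambda>x. \<alpha> x w)"
  shows "isCont (\<lambda>x. sharp G x (\<alpha> x)) x0"
proof -
  define Y where "Y x = sharp G x (\<alpha> x)" for x
  have Y: "G x (Y x) w = \<alpha> x w" if "x \<in> S" for x w
    unfolding Y_def by (rule sharp_works[of G x "\<alpha> x", OF met[OF that] lin[OF that]])
  obtain c where c: "c > 0" "\<forall>\<^sub>F x in at x0. x \<in> S \<and> (\<forall>v. c * (norm v)\<^sup>2 \<le> G x v v)"
    by (rule coercive_near[of S x0 G, OF assms(1,2) met cont])
  define E where "E x = (\<Sum>b\<in>Basis. \<bar>\<alpha> x b - G x (Y x0) b\<bar>)" for x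
  have "continuous_on S E"
    unfolding E_def by (intro continuous_intros cont cont\<alpha>)
  then have "(E \<longlongrightarrow> E x0) (at x0)"
    using assms(1,2) by (simp add: continuous_on_eq_continuous_at isCont_def)
  then have E: "(E \<longlongrightarrow> 0) (at x0)" using Y[OF assms(2)] by (simp add: E_def)
  have "\<forall>\<^sub>F x in at x0. norm (Y x - Y x0) \<le> E x / c"
    using c(2)
  proof eventually_elim
    case (elim x)
    define z where "z = Y x - Y x0"
    have lz: "G x z w = \<alpha> x w - G x (Y x0) w" for w
      using linear_diff[OF inner_product_form_linear(2)[OF met], of x "Y x" "Y x0" w] elim Y
      by (simp add: z_def)
    have lh: "linear (G x z)" using elim by (intro inner_product_form_linear(1) met) auto
    \<comment> \<open>Testing the equation for the difference z with z itself bounds its norm by the data.\<close>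
    have "c * (norm z)\<^sup>2 \<le> G x z z" using elim by simp
    also have "\<dots> = (\<Sum>b\<in>Basis. (z \<bullet> b) * G x z b)"
      using linear_expand[OF lh, of z] by simp
    also have "\<dots> \<le> (\<Sum>b\<in>Basis. norm z * \<bar>G x z b\<bar>)"
    proof (rule sum_mono)
      fix b :: 'e assume "b \<in> Basis"
      then have "\<bar>z \<bullet> b\<bar> * \<bar>G x z b\<bar> \<le> norm z * \<bar>G x z b\<bar>"
        by (intro mult_right_mono Basis_le_norm) auto
      then show "(z \<bullet> b) * G x z b \<le> norm z * \<bar>G x z b\<bar>"
        using abs_ge_self[of "(z \<bullet> b) * G x z b"] by (simp add: abs_mult)
    qed
    also have "\<dots> = norm z * E x"
      by (simp add: E_def lz sum_distrib_left)
    finally have "norm z * (c * norm z) \<le> norm z * E x"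
      by (simp add: power2_eq_square ac_simps)
    moreover have "0 \<le> E x" by (simp add: E_def sum_nonneg)
    ultimately have "c * norm z \<le> E x"
      by (cases "z = 0") (auto dest!: mult_left_le_imp_le)
    then show ?case using c by (simp add: z_def field_simps)
  qed
  moreover have "((\<lambda>x. E x / c) \<longlongrightarrow> 0) (at x0)"
    using tendsto_divide[OF E tendsto_const, of c] c by simp
  ultimately have "((\<lambda>x. Y x - Y x0) \<longlongrightarrow> 0) (at x0)"
    by (rule Lim_null_comparison)
  then show ?thesis
    unfolding isCont_def Y_def[symmetric] using LIM_zero_cancel by blast
qed

text \<open>Where the differentiable factor vanishes, the other factor only needs to be continuous. This allows
  the inverse matrix to be differentiated knowing only that it is continuous.\<close>

lemma has_derivative_vanishing_scaleR:
  fixes \<phi> :: "'a::real_normed_vector \<Rightarrow> real" and P :: "'a \<Rightarrow> 'b::real_normed_vector"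
  assumes "(\<phi> has_derivative \<phi>') (at x)" "\<phi> x = 0" "isCont P x"
  shows "((\<lambda>y. \<phi> y *\<^sub>R P y) has_derivative (\<lambda>u. \<phi>' u *\<^sub>R P x)) (at x)"
proof -
  obtain K where K: "K > 0" "\<And>u. norm (\<phi>' u) \<le> norm u * K"
    using bounded_linear.pos_bounded[OF has_derivative_bounded_linear[OF assms(1)]] by blast
  have "((\<lambda>y. \<phi> y *\<^sub>R (P y - P x)) has_derivative (\<lambda>u. 0)) (at x)"
    unfolding has_derivative_within_alt2
  proof (intro conjI allI impI)
    fix e :: real assume e: "e > 0"
    have "\<forall>\<^sub>F y in at x. norm (\<phi> y - \<phi> x - \<phi>' (y - x)) \<le> 1 * norm (y - x)"
      using assms(1) unfolding has_derivative_within_alt2 by (meson zero_less_one)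
    moreover have "\<forall>\<^sub>F y in at x. dist (P y) (P x) < e / (K + 1)"
      using assms(3) e K by (intro tendstoD) (auto simp: isCont_def)
    ultimately show "\<forall>\<^sub>F y in at x. norm (\<phi> y *\<^sub>R (P y - P x) - \<phi> x *\<^sub>R (P x - P x) - 0) \<le> e * norm (y - x)"
    proof eventually_elim
      case (elim y)
      have "norm (\<phi> y) \<le> norm (y - x) * (K + 1)"
        using elim(1) K(2)[of "y - x"] assms(2) by (simp add: algebra_simps)
      then have "norm (\<phi> y) * norm (P y - P x) \<le> norm (y - x) * (K + 1) * (e / (K + 1))"
        using elim(2) K by (intro mult_mono) (auto simp: dist_norm)
      then show ?case using K by (simp add: mult.commute)
    qed
  qed simp
  moreover have "((\<lambda>y. \<phi> y *\<^sub>R P x) has_derivative (\<lambda>u. \<phi>' u *\<^sub>R P x)) (at x)"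
    by (intro has_derivative_scaleR_left assms)
  ultimately have "((\<lambda>y. \<phi> y *\<^sub>R (P y - P x) + \<phi> y *\<^sub>R P x) has_derivative (\<lambda>u. 0 + \<phi>' u *\<^sub>R P x)) (at x)"
    by (rule has_derivative_add)
  then show ?thesis by (simp add: scaleR_diff_right)
qed

lemma differentiable_sharp:
  fixes G :: "'e::euclidean_space bilinear_field"
  assumes "open S" "x0 \<in> S" and met: "\<And>x. x \<in> S \<Longrightarrow> inner_product_form (G x)"
    and sm: "\<And>u v. smooth_on (\<lambda>x. G x u v) S"
    and lin: "\<And>x. x \<in> S \<Longrightarrow> linear (\<alpha> x)" and diff: "\<And>w. (\<lambda>x. \<alpha> x w) differentiable at x0"
  shows "(\<lambda>x. sharp G x (\<alpha> x)) differentiable at x0"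
proof -
  define Y where "Y x = sharp G x (\<alpha> x)" for x
  have Y: "G x (Y x) w = \<alpha> x w" if "x \<in> S" for x w
    unfolding Y_def by (rule sharp_works[of G x "\<alpha> x", OF met[OF that] lin[OF that]])
  \<comment> \<open>The columns of the inverse matrix; they are continuous by the previous result.\<close>
  define P where "P b x = sharp G x (\<lambda>w. b \<bullet> w)" for b x
  have P: "G x (P b x) w = b \<bullet> w" if "x \<in> S" for x w b
    unfolding P_def
    by (rule sharp_works[of G x "\<lambda>w. b \<bullet> w", OF met[OF that]
          bounded_linear.linear[OF bounded_linear_inner_right]])
  have contP: "isCont (P b) x0" for b
    unfolding P_def
    by (rule continuous_at_sharp[OF assms(1,2) met smooth_on_continuous[OF sm]])
      (use bounded_linear.linear[OF bounded_linear_inner_right] in \<open>auto intro: continuous_intros\<close>)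
  \<comment> \<open>How far Y x0 is from solving the equation at x. This vanishes at x0, and the inverse matrix maps it to Y x - Y x0.\<close>
  define h where "h b x = \<alpha> x b - G x (Y x0) b" for b x
  have "h b differentiable at x0" for b
    unfolding h_def
    by (intro differentiable_diff diff smooth_on_differentiable[OF sm assms(2)])
  then have "(h b has_derivative (\<lambda>u. dir_deriv (h b) u x0)) (at x0)" for b
    by (rule has_derivative_dir_deriv)
  then have "((\<lambda>x. h b x *\<^sub>R P b x) has_derivative (\<lambda>u. dir_deriv (h b) u x0 *\<^sub>R P b x0)) (at x0)" for b
    by (rule has_derivative_vanishing_scaleR) (simp_all add: contP h_def Y assms)
  then have "(\<lambda>x. h b x *\<^sub>R P b x) differentiable at x0" for b
    by (rule differentiableI)
  then have "(\<lambda>x. (\<Sum>b\<in>Basis. h b x *\<^sub>R P b x) + Y x0) differentiable at x0"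
    by (intro differentiable_add differentiable_sum differentiable_const) auto
  moreover have "(\<Sum>b\<in>Basis. h b x *\<^sub>R P b x) + Y x0 = Y x" if x: "x \<in> S" for x
  proof (rule inner_product_form_eqI[OF met[OF x]])
    fix w
    have l1: "linear (\<lambda>v. G x v w)" and l2: "linear (G x v)" for v
      using inner_product_form_linear[OF met[OF x]] by auto
    have "G x ((\<Sum>b\<in>Basis. h b x *\<^sub>R P b x) + Y x0) w = (\<Sum>b\<in>Basis. h b x * (b \<bullet> w)) + G x (Y x0) w"
      by (simp add: linear_add[OF l1] linear_sum[OF l1] linear_scale[OF l1] P x)
    also have "(\<Sum>b\<in>Basis. h b x * (b \<bullet> w)) = \<alpha> x w - G x (Y x0) w"
      using linear_expand[OF linear_compose_sub[OF lin[OF x] l2], of w "Y x0"]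
      by (simp add: h_def inner_commute mult.commute)
    finally show "G x ((\<Sum>b\<in>Basis. h b x *\<^sub>R P b x) + Y x0) w = G x (Y x) w"
      by (simp add: Y x)
  qed
  ultimately have "Y differentiable at x0"
    using differentiable_cong_open[OF assms(1,2),
        of "\<lambda>x. (\<Sum>b\<in>Basis. h b x *\<^sub>R P b x) + Y x0" Y] by simp
  then show ?thesis by (simp add: Y_def[abs_def])
qed

text \<open>Differentiating the equation $G(Y, w) = \alpha(w)$ shows that a derivative of $Y$ is again obtained by
  raising an index, the new form being $\partial\alpha - (\partial G)(Y, \cdot)$, which has one degree of
  smoothness less than $\alpha$. So the statement follows by induction on the order.\<close>

lemma Ck_on_sharp:
  fixes G :: "'e::euclidean_space bilinear_field"
  assumes "open S" and met: "\<And>x. x \<in> S \<Longrightarrow> inner_product_form (G x)"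
    and sm: "\<And>u v. smooth_on (\<lambda>x. G x u v) S"
    and "\<And>x. x \<in> S \<Longrightarrow> linear (\<alpha> x)" and "\<And>w. Ck_on k (\<lambda>x. \<alpha> x w) S"
  shows "Ck_on k (\<lambda>x. sharp G x (\<alpha> x)) S"
  using assms(4,5)
proof (induction k arbitrary: \<alpha>)
  case 0
  then show ?case
    using continuous_at_sharp[OF assms(1) _ met smooth_on_continuous[OF sm], of _ \<alpha>]
    by (simp add: continuous_at_imp_continuous_on)
next
  case (Suc k)
  define Y where "Y x = sharp G x (\<alpha> x)" for x
  have Y: "G x (Y x) w = \<alpha> x w" if "x \<in> S" for x w
    unfolding Y_def by (rule sharp_works[of G x "\<alpha> x", OF met[OF that] Suc.prems(1)[OF that]])
  have GL: "smooth_linear_on S (\<lambda>x v. G x v w)" for w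
    unfolding smooth_linear_on_def using inner_product_form_linear(2)[OF met] sm by blast
  have GR: "smooth_linear_on S (\<lambda>x w. G x v w)" for v
    unfolding smooth_linear_on_def using inner_product_form_linear(1)[OF met] sm by blast
  have dY: "Y differentiable at x" if "x \<in> S" for x
    unfolding Y_def
    by (rule differentiable_sharp[OF assms(1) that met sm]) (use Suc.prems that in auto)
  have CY: "Ck_on k Y S"
    unfolding Y_def using Suc.prems by (intro Suc.IH) (auto intro: Ck_on_pred)
  define \<beta> where "\<beta> u x w = dir_deriv (\<lambda>y. \<alpha> y w) u x - dir_deriv (\<lambda>y. G y (Y x) w) u x" for u x w
  have lin\<beta>: "linear (\<beta> u x)" if x: "x \<in> S" for u x
  proof -
    have "linear (\<lambda>w. dir_deriv (\<lambda>y. \<alpha> y w) u x)"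
    proof (rule linearI)
      fix v w :: 'e and c :: real
      have d: "(\<lambda>y. \<alpha> y v) differentiable at x" for v using Suc.prems x by auto
      have "dir_deriv (\<lambda>y. \<alpha> y (v + w)) u x = dir_deriv (\<lambda>y. \<alpha> y v + \<alpha> y w) u x"
        by (rule dir_deriv_cong[OF assms(1) x]) (simp add: Suc.prems linear_add)
      then show "dir_deriv (\<lambda>y. \<alpha> y (v + w)) u x = dir_deriv (\<lambda>y. \<alpha> y v) u x + dir_deriv (\<lambda>y. \<alpha> y w) u x"
        by (simp add: dir_deriv_add d)
      have "dir_deriv (\<lambda>y. \<alpha> y (c *\<^sub>R v)) u x = dir_deriv (\<lambda>y. c *\<^sub>R \<alpha> y v) u x"
        by (rule dir_deriv_cong[OF assms(1) x]) (simp add: Suc.prems linear_scale)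
      then show "dir_deriv (\<lambda>y. \<alpha> y (c *\<^sub>R v)) u x = c *\<^sub>R dir_deriv (\<lambda>y. \<alpha> y v) u x"
        by (subst (asm) dir_deriv_scaleR) (simp_all add: d)
    qed
    moreover have "linear (\<lambda>w. dir_deriv (\<lambda>y. G y (Y x) w) u x)"
      using smooth_linear_on_dir_deriv[OF assms(1) GR] x by (simp add: smooth_linear_on_def)
    ultimately show ?thesis
      unfolding \<beta>_def[abs_def] by (rule linear_compose_sub)
  qed
  have C\<beta>: "Ck_on k (\<lambda>x. \<beta> u x w) S" for u w
  proof -
    have "Ck_on k (\<lambda>x. dir_deriv (\<lambda>y. G y (Y x) w) u x) S"
      using smooth_linear_on_dir_deriv[OF assms(1) GL, of w u]
        Ck_on_family_apply[OF assms(1) _ _ CY, of "\<lambda>x v. dir_deriv (\<lambda>y. G y v w) u x"]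
      by (simp add: smooth_linear_on_def smooth_on_Ck)
    then have "Ck_on k (\<lambda>x. (-1) *\<^sub>R dir_deriv (\<lambda>y. G y (Y x) w) u x) S"
      by (rule Ck_on_bilinear[OF bounded_bilinear_scaleR assms(1) Ck_on_const])
    then have "Ck_on k (\<lambda>x. dir_deriv (\<lambda>y. \<alpha> y w) u x + (-1) *\<^sub>R dir_deriv (\<lambda>y. G y (Y x) w) u x) S"
      using Suc.prems(2)[of w] by (intro Ck_on_add[OF assms(1)]) auto
    then show ?thesis by (simp add: \<beta>_def)
  qed
  have "dir_deriv Y u x = sharp G x (\<beta> u x)" if x: "x \<in> S" for u x
  proof (rule sharp_eqI[of G x, OF met[OF x], symmetric])
    fix w
    have "((\<lambda>y. G y (Y y) w) has_derivative
        (\<lambda>u. dir_deriv (\<lambda>y. G y (Y x) w) u x + G x (dir_deriv Y u x) w)) (at x)"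
      by (rule family_has_derivative[where L = "\<lambda>x v. G x v w", OF assms(1) x
          inner_product_form_linear(2)[OF met] smooth_on_differentiable[OF sm x] dY[OF x]])
    then have "dir_deriv (\<lambda>y. G y (Y y) w) u x = dir_deriv (\<lambda>y. G y (Y x) w) u x + G x (dir_deriv Y u x) w"
      by (rule dir_deriv_eq)
    moreover have "dir_deriv (\<lambda>y. G y (Y y) w) u x = dir_deriv (\<lambda>y. \<alpha> y w) u x"
      using dir_deriv_cong[OF assms(1) x, of "\<lambda>y. G y (Y y) w" "\<lambda>y. \<alpha> y w"] Y by blast
    ultimately show "G x (dir_deriv Y u x) w = \<beta> u x w"
      by (simp add: \<beta>_def)
  qed
  moreover have "Ck_on k (\<lambda>x. sharp G x (\<beta> u x)) S" for u
    by (intro Suc.IH lin\<beta> C\<beta>)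
  ultimately have "Ck_on k (dir_deriv Y u) S" for u
    using Ck_on_cong[OF assms(1), of "\<lambda>x. sharp G x (\<beta> u x)"] by simp
  then show ?case
    using dY by (simp add: Y_def[abs_def])
qed

lemma smooth_on_sharp:
  fixes G :: "'e::euclidean_space bilinear_field"
  assumes "open S" and "\<And>x. x \<in> S \<Longrightarrow> inner_product_form (G x)"
    and "\<And>u v. smooth_on (\<lambda>x. G x u v) S"
    and "smooth_linear_on S \<alpha>"
  shows "smooth_on (\<lambda>x. sharp G x (\<alpha> x)) S"
  unfolding smooth_on_def
proof
  fix k
  show "Ck_on k (\<lambda>x. sharp G x (\<alpha> x)) S"
    by (rule Ck_on_sharp[OF assms(1-3)]) (use assms(4) in \<open>auto simp: smooth_linear_on_def smooth_on_Ck\<close>)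
qed

section \<open>The Levi-Civita connection on a coordinate domain\<close>

locale riemannian_domain =
  fixes U :: "'e::euclidean_space set" and G :: "'e bilinear_field"
  assumes open_U: "open U"
    and metric: "x \<in> U \<Longrightarrow> inner_product_form (G x)"
    and smooth_metric: "smooth_on (\<lambda>x. G x u v) U"
begin

abbreviation \<Gamma> :: "'e \<Rightarrow> 'e \<Rightarrow> 'e \<Rightarrow> 'e" where
  "\<Gamma> \<equiv> christoffel G"

text \<open>Vectors are extended to constant fields throughout, so a covariant derivative is only needed in a
  constant direction; the derivative of an endomorphism field evaluates the tensor $\nabla A$ on such
  vectors.\<close>

definition nabla :: "'e \<Rightarrow> ('e \<Rightarrow> 'e) \<Rightarrow> 'e \<Rightarrow> 'e" where
  "nabla u Y x = dir_deriv Y u x + \<Gamma> x u (Y x)"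

definition nabla_endo :: "'e \<Rightarrow> ('e \<Rightarrow> 'e \<Rightarrow> 'e) \<Rightarrow> 'e \<Rightarrow> 'e \<Rightarrow> 'e" where
  "nabla_endo u A x v = nabla u (\<lambda>y. A y v) x - A x (\<Gamma> x u v)"

lemma metric_sym: "x \<in> U \<Longrightarrow> G x u v = G x v u"
  using metric by (simp add: inner_product_form_def)

lemma metric_bilinear: "x \<in> U \<Longrightarrow> bilinear (G x)"
  using metric by (simp add: inner_product_form_def)

lemmas metric_bilinear_simps =
  bilinear_ladd[OF metric_bilinear] bilinear_radd[OF metric_bilinear]
  bilinear_lsub[OF metric_bilinear] bilinear_rsub[OF metric_bilinear]
  bilinear_lneg[OF metric_bilinear] bilinear_rneg[OF metric_bilinear]
  bilinear_lmul[OF metric_bilinear] bilinear_rmul[OF metric_bilinear]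
  bilinear_lzero[OF metric_bilinear] bilinear_rzero[OF metric_bilinear]

lemma metric_eqI: "x \<in> U \<Longrightarrow> (\<And>w. G x u w = G x v w) \<Longrightarrow> u = v"
  using inner_product_form_eqI[OF metric] by blast

lemma smooth_linear_metric:
  "smooth_linear_on U (\<lambda>x v. G x v w)" "smooth_linear_on U (\<lambda>x w. G x v w)"
  unfolding smooth_linear_on_def
  using inner_product_form_linear[OF metric] smooth_metric by blast+

lemma metric_deriv_sym: "x \<in> U \<Longrightarrow> dir_deriv (\<lambda>y. G y u v) w x = dir_deriv (\<lambda>y. G y v u) w x"
  using dir_deriv_cong[OF open_U, of x "\<lambda>y. G y u v" "\<lambda>y. G y v u"] metric_sym by blast

lemma smooth_linear_koszul:
  "smooth_linear_on U (\<lambda>x w. (dir_deriv (\<lambda>y. G y v w) u x + dir_deriv (\<lambda>y. G y u w) v x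
     - dir_deriv (\<lambda>y. G y u v) w x) / 2)"
proof -
  have 1: "smooth_linear_on U (\<lambda>x w. dir_deriv (\<lambda>y. G y v w) u x)" for u v
    by (rule smooth_linear_on_dir_deriv[OF open_U smooth_linear_metric(2)])
  have 2: "linear (\<lambda>w. dir_deriv (\<lambda>y. G y u v) w x)" if "x \<in> U" for x
    by (rule dir_deriv_linear[OF smooth_on_differentiable[OF smooth_metric that]])
  have "linear (\<lambda>w. (dir_deriv (\<lambda>y. G y v w) u x + dir_deriv (\<lambda>y. G y u w) v x
     - dir_deriv (\<lambda>y. G y u v) w x) / 2)" if x: "x \<in> U" for x
    using 1[of v u] 1[of u v] 2[OF x] x
    by (simp add: smooth_linear_on_def linear_iff add_divide_distrib diff_divide_distrib algebra_simps)
  moreover have "smooth_on (\<lambda>x. (1/2) *\<^sub>R (dir_deriv (\<lambda>y. G y v w) u x + dir_deriv (\<lambda>y. G y u w) v x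
     - dir_deriv (\<lambda>y. G y u v) w x)) U" for w
    by (intro smooth_on_scaleR smooth_on_const smooth_on_add smooth_on_diff open_U
        smooth_on_dir_deriv smooth_metric)
  ultimately show ?thesis by (simp add: smooth_linear_on_def)
qed

lemma koszul:
  assumes "x \<in> U"
  shows "G x (\<Gamma> x u v) w = (dir_deriv (\<lambda>y. G y v w) u x + dir_deriv (\<lambda>y. G y u w) v x
     - dir_deriv (\<lambda>y. G y u v) w x) / 2"
proof -
  have "linear (\<lambda>w. (dir_deriv (\<lambda>y. G y v w) u x + dir_deriv (\<lambda>y. G y u w) v x
     - dir_deriv (\<lambda>y. G y u v) w x) / 2)"
    using smooth_linear_koszul assms unfolding smooth_linear_on_def by blast
  from sharp_works[of G x, OF metric[OF assms] this]
  show ?thesis unfolding christoffel_def .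
qed

lemma christoffel_sym:
  assumes x: "x \<in> U"
  shows "\<Gamma> x u v = \<Gamma> x v u"
proof (rule metric_eqI[OF x])
  show "G x (\<Gamma> x u v) w = G x (\<Gamma> x v u) w" for w
    using koszul[OF x, of u v w] koszul[OF x, of v u w] metric_deriv_sym[OF x, of u v w]
    by (simp only: add.commute)
qed

lemma smooth_linear_christoffel:
  "smooth_linear_on U (\<lambda>x v. \<Gamma> x u v)" "smooth_linear_on U (\<lambda>x v. \<Gamma> x v u)"
proof -
  have s: "smooth_on (\<lambda>x. \<Gamma> x u v) U" for u v
    unfolding christoffel_def
    by (rule smooth_on_sharp[OF open_U metric smooth_metric smooth_linear_koszul])
  have l: "linear (\<Gamma> x u)" if x: "x \<in> U" for x u
  proof (rule linearI; rule metric_eqI[OF x])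
    have L: "linear (\<lambda>v. dir_deriv (\<lambda>y. G y v w) u x)" "linear (\<lambda>v. dir_deriv (\<lambda>y. G y u v) w x)"
      "linear (\<lambda>v. dir_deriv (\<lambda>y. G y u w) v x)" for w
      using smooth_linear_on_dir_deriv[OF open_U smooth_linear_metric(1), of w u]
        smooth_linear_on_dir_deriv[OF open_U smooth_linear_metric(2), of u w]
        dir_deriv_linear[OF smooth_on_differentiable[OF smooth_metric x], of u w] x
      by (simp_all add: smooth_linear_on_def)
    show "G x (\<Gamma> x u (a + b)) w = G x (\<Gamma> x u a + \<Gamma> x u b) w" for a b w
      using L[of w] by (simp add: x koszul metric_bilinear_simps linear_iff add_divide_distrib diff_divide_distrib)
    show "G x (\<Gamma> x u (c *\<^sub>R a)) w = G x (c *\<^sub>R \<Gamma> x u a) w" for c a w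
      using L[of w] by (simp add: x koszul metric_bilinear_simps linear_iff algebra_simps)
  qed
  show "smooth_linear_on U (\<lambda>x v. \<Gamma> x u v)"
    using s l by (simp add: smooth_linear_on_def)
  have "linear (\<lambda>v. \<Gamma> x v u)" if "x \<in> U" for x
    using l[OF that, of u] christoffel_sym[OF that, of _ u] by simp
  then show "smooth_linear_on U (\<lambda>x v. \<Gamma> x v u)"
    using s by (simp add: smooth_linear_on_def)
qed

lemma christoffel_linear:
  assumes "x \<in> U"
  shows "linear (\<Gamma> x u)" "linear (\<lambda>v. \<Gamma> x v u)"
  using smooth_linear_christoffel assms by (simp_all add: smooth_linear_on_def)

lemma smooth_christoffel: "smooth_on (\<lambda>x. \<Gamma> x u v) U"
  using smooth_linear_christoffel by (simp add: smooth_linear_on_def)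

lemma smooth_nabla: "smooth_on Y U \<Longrightarrow> smooth_on (nabla u Y) U"
  unfolding nabla_def[abs_def]
  by (intro smooth_on_add open_U smooth_on_dir_deriv
      smooth_on_family_apply[OF open_U smooth_linear_christoffel(1)])

lemma smooth_nabla_family:
  assumes "smooth_on Y U"
  shows "smooth_linear_on U (\<lambda>x u. nabla u Y x)"
proof -
  have "linear (\<lambda>u. nabla u Y x)" if "x \<in> U" for x
    unfolding nabla_def
    by (rule linear_compose_add)
      (use dir_deriv_linear[OF smooth_on_differentiable[OF assms that]] christoffel_linear[OF that] in auto)
  then show ?thesis
    using smooth_nabla[OF assms] by (simp add: smooth_linear_on_def)
qed

lemma nabla_cong:
  "x \<in> U \<Longrightarrow> (\<And>y. y \<in> U \<Longrightarrow> Y y = Z y) \<Longrightarrow> nabla u Y x = nabla u Z x"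
  unfolding nabla_def using dir_deriv_cong[OF open_U, of x Y Z u] by simp

lemma nabla_add:
  assumes "x \<in> U" "smooth_on Y U" "smooth_on Z U"
  shows "nabla u (\<lambda>y. Y y + Z y) x = nabla u Y x + nabla u Z x"
  using assms unfolding nabla_def
  by (simp add: dir_deriv_add smooth_on_differentiable linear_add[OF christoffel_linear(1)])

lemma nabla_scaleR:
  assumes "x \<in> U" "smooth_on Y U"
  shows "nabla u (\<lambda>y. c *\<^sub>R Y y) x = c *\<^sub>R nabla u Y x"
  using assms unfolding nabla_def
  by (simp add: dir_deriv_scaleR smooth_on_differentiable linear_scale[OF christoffel_linear(1)]
      scaleR_add_right)

lemma nabla_const: "nabla u (\<lambda>_. v) x = \<Gamma> x u v"
  by (simp add: nabla_def)

lemma lie_bracket_nabla: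
  "x \<in> U \<Longrightarrow> lie_bracket P Q x = nabla (P x) Q x - nabla (Q x) P x"
  by (simp add: lie_bracket_def nabla_def christoffel_sym[of x "Q x"])

lemma nabla_direction_scaleR:
  assumes "x \<in> U" "smooth_on Y U"
  shows "nabla (c *\<^sub>R u) Y x = c *\<^sub>R nabla u Y x"
  using smooth_nabla_family[OF assms(2)] assms(1) linear_scale[of "\<lambda>u. nabla u Y x" c u]
  by (simp add: smooth_linear_on_def)

text \<open>The sum of two instances of the Koszul formula, in which all but one derivative of the metric cancel.\<close>

lemma metric_compat_const:
  assumes "x \<in> U"
  shows "dir_deriv (\<lambda>y. G y v w) u x = G x (\<Gamma> x u v) w + G x v (\<Gamma> x u w)"
  using assms koszul[OF assms, of u v w] koszul[OF assms, of u w v]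
    metric_deriv_sym[OF assms, of v w] metric_deriv_sym[OF assms, of u w] metric_deriv_sym[OF assms, of u v]
    metric_sym[OF assms, of v "\<Gamma> x u w"]
  by (simp add: field_simps)

lemma metric_compat:
  assumes x: "x \<in> U" and V: "smooth_on V U" and W: "smooth_on W U"
  shows "dir_deriv (\<lambda>y. G y (V y) (W y)) u x = G x (nabla u V x) (W x) + G x (V x) (nabla u W x)"
proof -
  have L: "smooth_linear_on U (\<lambda>y w. G y (V y) w)"
    using inner_product_form_linear(1)[OF metric]
      smooth_on_family_apply[OF open_U smooth_linear_metric(1) V]
    by (simp add: smooth_linear_on_def)
  have "dir_deriv (\<lambda>y. G y (V y) (W y)) u x = dir_deriv (\<lambda>y. G y (V y) (W x)) u x + G x (V x) (dir_deriv W u x)"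
    by (rule dir_deriv_family[where L = "\<lambda>y w. G y (V y) w", OF open_U L W x])
  also have "dir_deriv (\<lambda>y. G y (V y) (W x)) u x
      = dir_deriv (\<lambda>y. G y (V x) (W x)) u x + G x (dir_deriv V u x) (W x)"
    by (rule dir_deriv_family[where L = "\<lambda>y v. G y v (W x)", OF open_U smooth_linear_metric(1) V x])
  finally show ?thesis
    by (simp add: metric_compat_const x nabla_def metric_bilinear_simps)
qed

lemma nabla_endo_apply:
  assumes x: "x \<in> U" and A: "smooth_linear_on U A" and V: "smooth_on V U"
  shows "nabla u (\<lambda>y. A y (V y)) x = nabla_endo u A x (V x) + A x (nabla u V x)"
proof -
  have "linear (A x)" using A x by (simp add: smooth_linear_on_def)
  then show ?thesis
    using dir_deriv_family[OF open_U A V x, of u]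
    by (simp add: nabla_def nabla_endo_def linear_add)
qed

section \<open>Curvature\<close>

lemma Rm_eq:
  assumes "x \<in> U"
  shows "Rm G x u v w = nabla u (\<lambda>y. \<Gamma> y v w) x - nabla v (\<lambda>y. \<Gamma> y u w) x"
proof -
  have "cov G (\<lambda>_. v) (\<lambda>_. w) = (\<lambda>y. \<Gamma> y v w)" for v w
    by (simp add: cov_def[abs_def])
  moreover have "cov G (lie_bracket (\<lambda>_. u) (\<lambda>_. v)) (\<lambda>_. w) x = 0"
    using linear_0[OF christoffel_linear(2)[OF assms]]
    by (simp add: cov_def lie_bracket_def)
  ultimately show ?thesis
    by (simp add: Rm_def curvature_def cov_def nabla_def)
qed

text \<open>The curvature is defined by constant fields. It computes the commutator on an arbitrary field $W$ as
  well, since the second derivatives of $W$ commute and the terms with one derivative of $W$ are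
  symmetric in $u$ and $v$.\<close>

lemma ricci_identity:
  assumes x: "x \<in> U" and W: "smooth_on W U"
  shows "nabla u (nabla v W) x - nabla v (nabla u W) x = Rm G x u v (W x)"
proof -
  have *: "nabla u (nabla v W) x = dir_deriv (dir_deriv W v) u x + dir_deriv (\<lambda>y. \<Gamma> y v (W x)) u x
      + \<Gamma> x v (dir_deriv W u x) + \<Gamma> x u (dir_deriv W v x) + \<Gamma> x u (\<Gamma> x v (W x))" for u v
  proof -
    have s: "smooth_on (\<lambda>y. \<Gamma> y v (W y)) U"
      by (rule smooth_on_family_apply[OF open_U smooth_linear_christoffel(1) W])
    have "dir_deriv (\<lambda>y. dir_deriv W v y + \<Gamma> y v (W y)) u x
        = dir_deriv (dir_deriv W v) u x + dir_deriv (\<lambda>y. \<Gamma> y v (W y)) u x"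
      by (intro dir_deriv_add smooth_on_differentiable[OF _ x] smooth_on_dir_deriv W s)
    moreover have "dir_deriv (\<lambda>y. \<Gamma> y v (W y)) u x
        = dir_deriv (\<lambda>y. \<Gamma> y v (W x)) u x + \<Gamma> x v (dir_deriv W u x)"
      by (rule dir_deriv_family[OF open_U smooth_linear_christoffel(1) W x])
    ultimately show ?thesis
      by (simp add: nabla_def[abs_def] linear_add[OF christoffel_linear(1)] x)
  qed
  show ?thesis
    unfolding * Rm_eq[OF x] by (simp add: dir_deriv_commute[OF W open_U x, of u v] nabla_def)
qed

lemma Rm_skew: "x \<in> U \<Longrightarrow> Rm G x u v w = - Rm G x v u w"
  by (simp add: Rm_eq)

lemma Rm_bianchi:
  assumes x: "x \<in> U"
  shows "Rm G x u v w + Rm G x v w u + Rm G x w u v = 0"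
proof -
  have *: "nabla a (\<lambda>y. \<Gamma> y b c) x = nabla a (\<lambda>y. \<Gamma> y c b) x" for a b c
    by (rule nabla_cong[OF x christoffel_sym])
  show ?thesis
    unfolding Rm_eq[OF x] by (simp add: *[of u v w] *[of v w u] *[of w u v])
qed

text \<open>Second derivatives of the function $g(w,z)$ commute; expanded by metric compatibility, this is the
  skewness of the curvature in its last two slots.\<close>

lemma Rm_metric_skew:
  assumes x: "x \<in> U"
  shows "G x (Rm G x u v w) z = - G x w (Rm G x u v z)"
proof -
  have *: "dir_deriv (dir_deriv (\<lambda>y. G y w z) v) u x = G x (nabla u (\<lambda>y. \<Gamma> y v w) x) z
      + G x (\<Gamma> x v w) (\<Gamma> x u z) + G x (\<Gamma> x u w) (\<Gamma> x v z) + G x w (nabla u (\<lambda>y. \<Gamma> y v z) x)" for u v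
  proof -
    have "dir_deriv (dir_deriv (\<lambda>y. G y w z) v) u x
        = dir_deriv (\<lambda>y. G y (\<Gamma> y v w) z + G y w (\<Gamma> y v z)) u x"
      by (rule dir_deriv_cong[OF open_U x metric_compat_const])
    also have "\<dots> = dir_deriv (\<lambda>y. G y (\<Gamma> y v w) z) u x + dir_deriv (\<lambda>y. G y w (\<Gamma> y v z)) u x"
      by (intro dir_deriv_add smooth_on_differentiable[OF _ x]
          smooth_on_family_apply[OF open_U smooth_linear_metric(1)]
          smooth_on_family_apply[OF open_U smooth_linear_metric(2)] smooth_christoffel)
    also have "\<dots> = G x (nabla u (\<lambda>y. \<Gamma> y v w) x) z
      + G x (\<Gamma> x v w) (\<Gamma> x u z) + G x (\<Gamma> x u w) (\<Gamma> x v z) + G x w (nabla u (\<lambda>y. \<Gamma> y v z) x)"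
      using metric_compat[OF x smooth_christoffel smooth_on_const, of v w z u]
        metric_compat[OF x smooth_on_const smooth_christoffel, of w v z u]
      by (simp add: nabla_def)
    finally show ?thesis .
  qed
  show ?thesis
    using *[of u v] *[of v u] dir_deriv_commute[OF smooth_metric open_U x, of w z u v]
    by (simp add: Rm_eq x metric_bilinear_simps)
qed

text \<open>The classical octahedron argument: a sum of four instances of the first Bianchi identity, with the
  skew symmetries.\<close>

lemma Rm_pair_sym:
  assumes x: "x \<in> U"
  shows "G x (Rm G x u v w) z = G x (Rm G x w z u) v"
proof -
  define R where "R a b c d = G x (Rm G x a b c) d" for a b c d
  have s1: "R a b c d = - R b a c d" for a b c d
    unfolding R_def by (subst Rm_skew[OF x]) (simp add: metric_bilinear_simps x)
  have s2: "R a b c d = - R a b d c" for a b c d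
    unfolding R_def by (subst Rm_metric_skew[OF x]) (simp add: metric_sym x)
  have b: "R a b c d + R b c a d + R c a b d = 0" for a b c d
    using arg_cong[OF Rm_bianchi[OF x, of a b c], of "\<lambda>r. G x r d"]
    by (simp add: R_def metric_bilinear_simps x)
  have "R u v w z = R w z u v"
    using b[of u v w z] b[of v w z u] b[of w z u v] b[of z u v w]
      s1[of u v w z] s1 s2 by (smt (verit))
  then show ?thesis by (simp add: R_def)
qed

lemma Rm_linear_second:
  assumes x: "x \<in> U"
  shows "linear (\<lambda>v. Rm G x u v w)"
proof -
  have "linear (\<lambda>v. nabla u (\<lambda>y. \<Gamma> y v w) x)"
    using smooth_linear_on_dir_deriv[OF open_U smooth_linear_christoffel(2), of w u] x
      christoffel_linear[OF x]
    by (simp add: nabla_def smooth_linear_on_def linear_iff algebra_simps)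
  moreover have "linear (\<lambda>v. nabla v (\<lambda>y. \<Gamma> y u w) x)"
    using smooth_nabla_family[OF smooth_christoffel] x by (simp add: smooth_linear_on_def)
  ultimately show ?thesis
    unfolding Rm_eq[OF x] by (rule linear_compose_sub)
qed

lemma Rm_linear_first:
  assumes x: "x \<in> U"
  shows "linear (\<lambda>u. Rm G x u v w)"
proof -
  have "(\<lambda>u. Rm G x u v w) = (\<lambda>u. - Rm G x v u w)"
    using Rm_skew[OF x] by blast
  then show ?thesis
    using linear_compose_neg[OF Rm_linear_second[OF x]] by simp
qed

end

section \<open>Kaehler geometry on a coordinate domain\<close>

locale kahler_domain = riemannian_domain U G
  for U :: "'e::euclidean_space set" and G :: "'e bilinear_field" +
  fixes J :: "'e \<Rightarrow> 'e \<Rightarrow> 'e"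
  assumes smooth_J: "smooth_on (\<lambda>x. J x u) U"
    and linear_J: "x \<in> U \<Longrightarrow> linear (J x)"
    and J_J: "x \<in> U \<Longrightarrow> J x (J x u) = - u"
    and hermitian: "x \<in> U \<Longrightarrow> G x (J x u) (J x v) = G x u v"
    and closed: "x \<in> U \<Longrightarrow> ext_deriv2 (kahler_form G J) x u v w = 0"
    and integrable: "x \<in> U \<Longrightarrow> nijenhuis J x u v = 0"
begin

lemma smooth_linear_J: "smooth_linear_on U J"
  using smooth_J linear_J by (simp add: smooth_linear_on_def)

lemma J_simps:
  assumes "x \<in> U"
  shows "J x (u + v) = J x u + J x v" "J x (u - v) = J x u - J x v" "J x (- u) = - J x u"
    "J x (c *\<^sub>R u) = c *\<^sub>R J x u" "J x 0 = 0"
  using linear_J[OF assms] by (simp_all add: linear_add linear_diff linear_neg linear_scale linear_0)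

lemma metric_J_skew: "x \<in> U \<Longrightarrow> G x (J x u) v = - G x u (J x v)"
  using hermitian[of x u "J x v"] by (simp add: J_J metric_bilinear_simps)

lemma nabla_J_const: "nabla u (\<lambda>y. J y v) x = nabla_endo u J x v + J x (\<Gamma> x u v)"
  by (simp add: nabla_endo_def)

lemma dir_deriv_kahler_form:
  assumes x: "x \<in> U"
  shows "dir_deriv (\<lambda>y. G y (J y v) w) u x
    = G x (nabla_endo u J x v) w + G x (J x (\<Gamma> x u v)) w + G x (J x v) (\<Gamma> x u w)"
  using metric_compat[OF x smooth_J smooth_on_const, of v w u]
  by (simp add: nabla_J_const nabla_const metric_bilinear_simps x)

text \<open>The derivative of $J^2 = -1$.\<close>

lemma nabla_endo_J_anticommute:
  assumes x: "x \<in> U"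
  shows "nabla_endo u J x (J x v) = - J x (nabla_endo u J x v)"
proof -
  have "nabla u (\<lambda>y. J y (J y v)) x = nabla u (\<lambda>y. - v) x"
    by (rule nabla_cong[OF x J_J])
  then show ?thesis
    unfolding nabla_endo_apply[OF x smooth_linear_J smooth_J]
    by (simp add: nabla_J_const nabla_const J_simps x J_J linear_neg[OF christoffel_linear(1)]
        eq_neg_iff_add_eq_0)
qed

text \<open>The derivative of the skewness of $J$.\<close>

lemma nabla_endo_J_skew:
  assumes x: "x \<in> U"
  shows "G x (nabla_endo u J x v) w = - G x v (nabla_endo u J x w)"
proof -
  have "dir_deriv (\<lambda>y. G y (J y v) w) u x = dir_deriv (\<lambda>y. - G y (J y w) v) u x"
  proof (rule dir_deriv_cong[OF open_U x])
    show "G y (J y v) w = - G y (J y w) v" if "y \<in> U" for y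
      using metric_J_skew[OF that, of v w] metric_sym[OF that, of v "J y w"] by (simp only:)
  qed
  also have "\<dots> = - dir_deriv (\<lambda>y. G y (J y w) v) u x"
    using smooth_on_differentiable[OF smooth_on_family_apply[OF open_U smooth_linear_metric(1) smooth_J] x]
    by (intro dir_deriv_eq has_derivative_minus has_derivative_dir_deriv)
  finally show ?thesis
    unfolding dir_deriv_kahler_form[OF x]
    by (simp add: metric_J_skew x metric_sym[OF x, of "\<Gamma> x u v"] metric_sym[OF x, of "\<Gamma> x u w"]
        metric_sym[OF x, of v "nabla_endo u J x w"])
qed

text \<open>Let $c(u,v,w) = g((\nabla_u J)v, w)$. Closedness of the Kaehler form is the vanishing of the cyclic sum of
  $c$, and the Nijenhuis tensor is an alternation of $\nabla J$. With the two symmetries of $c$ coming from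
  $J^2 = -1$ and from the compatibility of $J$ with the metric, the cyclic sums at $(u,v,w)$ and
  $(u,Jv,Jw)$ and the Nijenhuis identity at $(v,w)$ paired with $Ju$ combine to $2c = 0$.\<close>

lemma J_parallel:
  assumes x: "x \<in> U"
  shows "nabla_endo u J x v = 0"
proof (rule metric_eqI[OF x])
  fix w
  define c where "c u v w = G x (nabla_endo u J x v) w" for u v w
  have c1: "c u (J x v) w = c u v (J x w)" for u v w
    by (simp add: c_def nabla_endo_J_anticommute x metric_bilinear_simps metric_J_skew)
  have c2: "c u v w = - c u w v" for u v w
    by (simp add: c_def nabla_endo_J_skew[OF x, of u v w] metric_sym[OF x, of v])
  have c3: "c u v w + c v w u + c w u v = 0" for u v w
    using closed[OF x, of u v w]
    unfolding ext_deriv2_def kahler_form_def dir_deriv_kahler_form[OF x]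
    by (simp add: c_def metric_J_skew x christoffel_sym[OF x, of v u] christoffel_sym[OF x, of w u]
        christoffel_sym[OF x, of w v] metric_sym[OF x, of "\<Gamma> x u v"] metric_sym[OF x, of "\<Gamma> x u w"]
        metric_sym[OF x, of "\<Gamma> x v w"])
  have D: "dir_deriv (\<lambda>y. J y v) a x = nabla_endo a J x v + J x (\<Gamma> x a v) - \<Gamma> x a (J x v)" for a v
    using nabla_J_const[of a v x] by (simp add: nabla_def eq_diff_eq)
  have "nabla_endo (J x v) J x w - nabla_endo (J x w) J x v
      + J x (nabla_endo w J x v) - J x (nabla_endo v J x w) = 0" for v w
    using integrable[OF x, of v w]
    by (simp add: nijenhuis_def lie_bracket_def D J_simps x J_J christoffel_sym[OF x, of w v]
        christoffel_sym[OF x, of "J x v" w] christoffel_sym[OF x, of "J x w" v]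
        christoffel_sym[OF x, of "J x v" "J x w"] algebra_simps)
  from arg_cong[OF this, of "\<lambda>r. G x r _"]
  have c4: "c (J x v) w z - c (J x w) v z - c w v (J x z) + c v w (J x z) = 0" for v w z
    by (simp add: metric_bilinear_simps x c_def metric_J_skew)
  have m: "c a b (- d) = - c a b d" for a b d
    by (simp add: c_def metric_bilinear_simps x)
  have "c u (J x v) (J x w) = - c u v w"
    by (simp add: c1 J_J x m)
  moreover have "c (J x v) w (J x u) = c (J x v) (J x w) u" "c (J x w) v (J x u) = - c (J x w) u (J x v)"
    using c1[of "J x v" w u] c2[of "J x w" v "J x u"] c1[of "J x w" u v] by simp_all
  moreover have "c v w (J x (J x u)) = - c v w u" "c w v (J x (J x u)) = - c w v u"
    by (simp_all add: J_J x m)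
  ultimately have "2 * c u v w = 0"
    using c4[of v w "J x u"] c3[of u v w] c3[of u "J x v" "J x w"] c2[of w v u] by linarith
  then show "G x (nabla_endo u J x v) w = G x 0 w"
    by (simp add: c_def metric_bilinear_simps x)
qed

lemma nabla_J:
  "x \<in> U \<Longrightarrow> smooth_on V U \<Longrightarrow> nabla u (\<lambda>y. J y (V y)) x = J x (nabla u V x)"
  by (simp add: nabla_endo_apply[OF _ smooth_linear_J] J_parallel)

lemma Rm_J:
  assumes x: "x \<in> U"
  shows "Rm G x u v (J x w) = J x (Rm G x u v w)"
proof -
  have "nabla u (nabla v (\<lambda>y. J y w)) x = J x (nabla u (\<lambda>y. \<Gamma> y v w) x)" for u v
  proof -
    have "nabla u (nabla v (\<lambda>y. J y w)) x = nabla u (\<lambda>y. J y (\<Gamma> y v w)) x"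
      by (rule nabla_cong[OF x]) (simp add: nabla_J_const J_parallel)
    then show ?thesis by (simp add: nabla_J x smooth_christoffel)
  qed
  then show ?thesis
    using ricci_identity[OF x smooth_J, of u v w] by (simp add: Rm_eq x J_simps)
qed

text \<open>Pair symmetry moves the commutation of the curvature operator with $J$ to the first two slots.\<close>

lemma Rm_J_J:
  assumes x: "x \<in> U"
  shows "Rm G x (J x u) (J x v) w = Rm G x u v w"
proof (rule metric_eqI[OF x])
  show "G x (Rm G x (J x u) (J x v) w) z = G x (Rm G x u v w) z" for z
    unfolding Rm_pair_sym[OF x, of _ _ w z] by (simp add: Rm_J hermitian x)
qed

lemma Ric_J:
  assumes x: "x \<in> U"
  shows "Ric G x (J x u) (J x v) = Ric G x u v"
proof -
  \<comment> \<open>Moving J from the second slot to the first changes the sign, because J squares to -1.\<close>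
  have "Rm G x w (J x u) (J x v) = J x (- Rm G x (J x w) u v)" for w
    using Rm_J_J[OF x, of w "J x u" v] linear_neg[OF Rm_linear_second[OF x], of "J x w" u v]
    by (simp add: Rm_J J_J x)
  then have "Ric G x (J x u) (J x v) = endo_trace (\<lambda>w. J x (- Rm G x (J x w) u v))"
    by (simp add: Ric_def)
  also have "\<dots> = endo_trace (\<lambda>w. - Rm G x (J x (J x w)) u v)"
    using linear_compose[OF linear_J[OF x] linear_compose_neg[OF Rm_linear_first[OF x]], of u v]
    by (intro endo_trace_commute[OF linear_J[OF x]]) (simp add: o_def)
  also have "\<dots> = Ric G x u v"
    using linear_neg[OF Rm_linear_first[OF x], of _ u v] by (simp add: J_J x Ric_def)
  finally show ?thesis .
qed

text \<open>In the complexified bracket $[W, Z]$ of $W = \frac12(u + iJu)$ and $Z = \frac12(V - iJV)$ the Christoffel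
  terms cancel after projection to $T^{1,0}$, because $J$ is parallel. What remains is a multiple of
  $\nabla_u V + J\nabla_{Ju} V$.\<close>

lemma holomorphic_field:
  assumes x: "x \<in> U" and V: "smooth_on V U"
    and dbar0: "dbar J (\<lambda>y. part10 J y (V y, 0)) x u = 0"
  shows "nabla (J x u) V x = J x (nabla u V x)"
proof -
  \<comment> \<open>Outside U nothing is known about J, so P and Z are replaced by explicit fields only on U.\<close>
  define P where "P y = part01 J y (u, 0)" for y
  define Z where "Z y = part10 J y (V y, 0)" for y
  have sJV: "smooth_on (\<lambda>y. J y (V y)) U"
    by (rule smooth_on_family_apply[OF open_U smooth_linear_J V])
  have P: "(fst \<circ> P) y = (1/2) *\<^sub>R u" "(snd \<circ> P) y = (1/2) *\<^sub>R J y u" if "y \<in> U" for y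
    using that by (simp_all add: P_def part01_def J_simps)
  have Z: "(fst \<circ> Z) y = (1/2) *\<^sub>R V y" "(snd \<circ> Z) y = (- 1/2) *\<^sub>R J y (V y)" if "y \<in> U" for y
    using that by (simp_all add: Z_def part10_def J_simps)
  have "nabla a (fst \<circ> P) x = nabla a (\<lambda>y. (1/2) *\<^sub>R u) x"
    "nabla a (snd \<circ> P) x = nabla a (\<lambda>y. (1/2) *\<^sub>R J y u) x"
    "nabla a (fst \<circ> Z) x = nabla a (\<lambda>y. (1/2) *\<^sub>R V y) x"
    "nabla a (snd \<circ> Z) x = nabla a (\<lambda>y. (- 1/2) *\<^sub>R J y (V y)) x" for a
    by (rule nabla_cong[OF x]; rule P Z; assumption)+
  then have d: "nabla a (fst \<circ> P) x = (1/2) *\<^sub>R \<Gamma> x a u"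
    "nabla a (snd \<circ> P) x = (1/2) *\<^sub>R J x (\<Gamma> x a u)"
    "nabla a (fst \<circ> Z) x = (1/2) *\<^sub>R nabla a V x"
    "nabla a (snd \<circ> Z) x = (- 1/2) *\<^sub>R J x (nabla a V x)" for a
    by (simp_all only: linear_scale[OF christoffel_linear(1)[OF x]] nabla_scaleR[OF x smooth_J]
        nabla_scaleR[OF x V] nabla_scaleR[OF x sJV] nabla_J[OF x V] nabla_const nabla_J_const
        J_parallel[OF x] add_0)
  have C: "\<Gamma> x (c *\<^sub>R a) b = c *\<^sub>R \<Gamma> x a b" for a b c
    using linear_scale[OF christoffel_linear(2)[OF x]] by simp
  define W where "W = complex_bracket P Z x"
  have "fst (part10 J x W) = 0"
    using dbar0 by (simp add: W_def P_def[abs_def] Z_def[abs_def] dbar_def)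
  then have "fst W + J x (snd W) = 0" by (simp add: part10_def)
  moreover have "fst W + J x (snd W) = (1/2) *\<^sub>R (nabla u V x + J x (nabla (J x u) V x))"
    unfolding W_def complex_bracket_def fst_conv snd_conv lie_bracket_nabla[OF x]
    unfolding P[OF x] Z[OF x] d nabla_direction_scaleR[OF x V] C
    by (simp add: J_simps x J_J algebra_simps flip: scaleR_add_left)
  ultimately have "nabla u V x + J x (nabla (J x u) V x) = 0" by simp
  then have "J x (nabla u V x + J x (nabla (J x u) V x)) = 0" by (simp add: J_simps x)
  then show ?thesis by (simp add: J_simps J_J x)
qed

end

section \<open>Extremal solitons\<close>

locale extremal_soliton_domain = kahler_domain U G J
  for U :: "'e::euclidean_space set" and G :: "'e bilinear_field" and J :: "'e \<Rightarrow> 'e \<Rightarrow> 'e" +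
  fixes \<phi> :: "'e \<Rightarrow> real"
  assumes smooth_potential: "smooth_on \<phi> U"
    and soliton: "x \<in> U \<Longrightarrow>
      Ric G x u v - G x u v = (1/2) * lie_derivative (grad G \<phi>) G x u v"
    and extremal: "x \<in> U \<Longrightarrow> dbar J (del_sharp G J (scal G)) x u = 0"
begin

definition soliton_field :: "'e \<Rightarrow> 'e" where
  "soliton_field = grad G \<phi>"

definition hess :: "'e \<Rightarrow> 'e \<Rightarrow> 'e" where
  "hess x u = nabla u soliton_field x"

definition nabla_hess :: "'e \<Rightarrow> 'e \<Rightarrow> 'e \<Rightarrow> 'e" where
  "nabla_hess x u v = nabla_endo u hess x v"

lemma smooth_soliton_field: "smooth_on soliton_field U"
proof -
  have "smooth_linear_on U (\<lambda>x. frechet_derivative \<phi> (at x))"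
    using smooth_on_dir_deriv[OF smooth_potential]
      linear_frechet_derivative[OF smooth_on_differentiable[OF smooth_potential]]
    by (simp add: smooth_linear_on_def)
  from smooth_on_sharp[OF open_U metric smooth_metric this]
  show ?thesis by (simp add: soliton_field_def grad_def[abs_def])
qed

lemma metric_soliton_field: "x \<in> U \<Longrightarrow> G x (soliton_field x) w = dir_deriv \<phi> w x"
  unfolding soliton_field_def grad_def
  using sharp_works[of G x "frechet_derivative \<phi> (at x)", OF metric
      linear_frechet_derivative[OF smooth_on_differentiable[OF smooth_potential]]] .

lemma smooth_linear_hess: "smooth_linear_on U hess"
  using smooth_nabla_family[OF smooth_soliton_field] by (simp add: hess_def[abs_def])

lemma linear_hess: "x \<in> U \<Longrightarrow> linear (hess x)"
  using smooth_linear_hess by (simp add: smooth_linear_on_def)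

lemma smooth_hess: "smooth_on (\<lambda>x. hess x u) U"
  using smooth_linear_hess by (simp add: smooth_linear_on_def)

text \<open>The symmetry of the second derivatives of the potential.\<close>

lemma hess_sym:
  assumes x: "x \<in> U"
  shows "G x (hess x u) v = G x u (hess x v)"
proof -
  have *: "G x (hess x u) v + G x (soliton_field x) (\<Gamma> x u v) = dir_deriv (dir_deriv \<phi> v) u x" for u v
    using metric_compat[OF x smooth_soliton_field smooth_on_const, of v u]
      dir_deriv_cong[OF open_U x, of "\<lambda>y. G y (soliton_field y) v" "dir_deriv \<phi> v" u] metric_soliton_field
    by (simp add: hess_def nabla_const)
  show ?thesis
    using *[of u v] *[of v u] dir_deriv_commute[OF smooth_potential open_U x, of u v]
      christoffel_sym[OF x, of u v] metric_sym[OF x, of u "hess x v"]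
    by simp
qed

text \<open>Metric compatibility and the symmetry of the Christoffel symbols turn the Lie derivative into the
  symmetrized covariant derivative of the gradient.\<close>

lemma lie_derivative_soliton_field:
  assumes x: "x \<in> U"
  shows "lie_derivative soliton_field G x u v = 2 * G x (hess x u) v"
proof -
  have "lie_derivative soliton_field G x u v = G x (hess x u) v + G x u (hess x v)"
    by (simp add: lie_derivative_def lie_bracket_def metric_compat_const[OF x] hess_def nabla_def
        metric_bilinear_simps x christoffel_sym[OF x, of "soliton_field x"])
  then show ?thesis by (simp add: hess_sym[OF x, of u v])
qed

lemma Ric_eq: "x \<in> U \<Longrightarrow> Ric G x u v = G x (u + hess x u) v"
  using soliton[of x u v] lie_derivative_soliton_field[of x u v]
  by (simp add: soliton_field_def metric_bilinear_simps)

text \<open>The gradient of the potential is holomorphic: its Hessian differs from the $J$-invariant Ricci form by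
  the $J$-invariant metric.\<close>

lemma hess_J:
  assumes x: "x \<in> U"
  shows "hess x (J x u) = J x (hess x u)"
proof (rule metric_eqI[OF x])
  fix w
  have "G x (hess x (J x u)) (J x v) = G x (J x (hess x u)) (J x v)" for v
    using Ric_J[OF x, of u v] by (simp add: Ric_eq x hermitian metric_bilinear_simps)
  from this[of "- J x w"] show "G x (hess x (J x u)) w = G x (J x (hess x u)) w"
    by (simp add: J_simps J_J x)
qed

text \<open>The Ricci identity for the gradient field; the terms $A(\nabla_u v)$ cancel since the connection has no
  torsion.\<close>

lemma nabla_hess_codazzi:
  assumes x: "x \<in> U"
  shows "nabla_hess x u v - nabla_hess x v u = Rm G x u v (soliton_field x)"
proof -
  have "nabla u (\<lambda>y. hess y v) x = nabla u (nabla v soliton_field) x" for u v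
    by (simp add: hess_def)
  then show ?thesis
    using ricci_identity[OF x smooth_soliton_field, of u v] by (simp add: nabla_hess_def nabla_endo_def christoffel_sym[OF x, of u v])
qed

text \<open>The derivative of $AJ = JA$, with $J$ parallel.\<close>

lemma nabla_hess_J:
  assumes x: "x \<in> U"
  shows "nabla_hess x u (J x v) = J x (nabla_hess x u v)"
proof -
  have "nabla u (\<lambda>y. hess y (J y v)) x = nabla u (\<lambda>y. J y (hess y v)) x"
    by (rule nabla_cong[OF x hess_J])
  then have "nabla_hess x u (J x v) + hess x (J x (\<Gamma> x u v)) = J x (nabla u (\<lambda>y. hess y v) x)"
    unfolding nabla_endo_apply[OF x smooth_linear_hess smooth_J] nabla_J[OF x smooth_hess]
    by (simp add: nabla_hess_def nabla_J_const J_parallel x)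
  then show ?thesis
    by (simp add: nabla_hess_def nabla_endo_def hess_J J_simps x eq_diff_eq)
qed

lemma nabla_hess_sym:
  assumes x: "x \<in> U"
  shows "G x (nabla_hess x u v) w = G x v (nabla_hess x u w)"
proof -
  have "dir_deriv (\<lambda>y. G y (hess y v) w) u x = dir_deriv (\<lambda>y. G y v (hess y w)) u x"
    by (rule dir_deriv_cong[OF open_U x hess_sym])
  then show ?thesis
    unfolding metric_compat[OF x smooth_hess smooth_on_const] metric_compat[OF x smooth_on_const smooth_hess]
    using hess_sym[OF x, of "\<Gamma> x u v" w] hess_sym[OF x, of v "\<Gamma> x u w"]
    by (simp add: nabla_hess_def nabla_endo_def nabla_const metric_bilinear_simps x)
qed

lemma linear_nabla_hess:
  assumes x: "x \<in> U"
  shows "linear (nabla_hess x u)"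
proof -
  have "linear (\<lambda>v. dir_deriv (\<lambda>y. hess y v) u x)"
    using smooth_linear_on_dir_deriv[OF open_U smooth_linear_hess] x by (simp add: smooth_linear_on_def)
  then show ?thesis
    using linear_hess[OF x] christoffel_linear(1)[OF x, of u]
    by (simp add: nabla_hess_def[abs_def] nabla_endo_def nabla_def linear_iff algebra_simps)
qed

text \<open>Exchanging the two slots of $B$ by the Ricci identity and moving $J$ out of the second slot, a $J$ in the
  first slot can be moved to the outside at the cost of curvature terms.\<close>

lemma nabla_hess_add_J:
  assumes x: "x \<in> U"
  shows "nabla_hess x u v + nabla_hess x (J x u) (J x v) = Rm G x u v (soliton_field x) + Rm G x (J x u) v (J x (soliton_field x))"
proof -
  have "nabla_hess x (J x u) v = J x (nabla_hess x v u) + Rm G x (J x u) v (soliton_field x)"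
    using nabla_hess_codazzi[OF x, of "J x u" v] nabla_hess_J[OF x, of v u] by (simp add: diff_eq_eq add.commute)
  also have "nabla_hess x v u = nabla_hess x u v - Rm G x u v (soliton_field x)"
    using nabla_hess_codazzi[OF x, of u v] by (simp add: diff_eq_eq eq_diff_eq add.commute)
  finally have "nabla_hess x (J x u) (J x v) = J x (J x (nabla_hess x u v - Rm G x u v (soliton_field x)) + Rm G x (J x u) v (soliton_field x))"
    by (simp only: nabla_hess_J x)
  then show ?thesis
    by (simp add: J_simps J_J x Rm_J)
qed

text \<open>In the trace of the previous identity the term $B(Ju,Jv)$ does not contribute, because it is a skew
  endomorphism in $v$; the two curvature terms contribute equally by the $J$-invariance of the Ricci
  tensor.\<close>

lemma trace_nabla_hess:
  assumes x: "x \<in> U"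
  shows "endo_trace (nabla_hess x u) = - 2 * Ric G x u (soliton_field x)"
proof -
  have "G x (nabla_hess x (J x u) (J x v)) w = - G x v (nabla_hess x (J x u) (J x w))" for v w
    by (simp add: nabla_hess_J x metric_J_skew nabla_hess_sym)
  then have "endo_trace (\<lambda>v. nabla_hess x (J x u) (J x v)) = 0"
    using linear_compose[OF linear_J[OF x] linear_nabla_hess[OF x]]
    by (intro endo_trace_skew[OF metric[OF x]]) (simp_all add: o_def)
  then have "endo_trace (nabla_hess x u) = endo_trace (\<lambda>v. nabla_hess x u v + nabla_hess x (J x u) (J x v))"
    by (simp add: endo_trace_add)
  also have "\<dots> = endo_trace (\<lambda>v. - Rm G x v u (soliton_field x)) + endo_trace (\<lambda>v. - Rm G x v (J x u) (J x (soliton_field x)))"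
    using Rm_skew[OF x, of u _ "soliton_field x"] Rm_skew[OF x, of "J x u" _ "J x (soliton_field x)"]
    by (simp add: nabla_hess_add_J x endo_trace_add[symmetric])
  also have "\<dots> = - 2 * Ric G x u (soliton_field x)"
    using Ric_J[OF x, of u "soliton_field x"] by (simp add: endo_trace_minus Ric_def)
  finally show ?thesis .
qed

text \<open>The soliton equation makes $1 + A$ the Ricci endomorphism. The difference between the derivative of $A$
  in coordinates and $\nabla A$ is a commutator, which has no trace.\<close>

lemma dir_deriv_scal:
  assumes x: "x \<in> U"
  shows "dir_deriv (scal G) u x = endo_trace (nabla_hess x u)"
proof -
  have "sharp G y (Ric G y v) = v + hess y v" if "y \<in> U" for y v
    by (rule sharp_eqI[of G y, OF metric[OF that]]) (simp add: Ric_eq that)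
  then have "scal G y = (\<Sum>b\<in>Basis. (b + hess y b) \<bullet> b)" if "y \<in> U" for y
    using that by (simp add: scal_def endo_trace_def)
  then have "dir_deriv (scal G) u x = dir_deriv (\<lambda>y. \<Sum>b\<in>Basis. (b + hess y b) \<bullet> b) u x"
    by (rule dir_deriv_cong[OF open_U x])
  also have "\<dots> = (\<Sum>b\<in>Basis. (0 + dir_deriv (\<lambda>y. hess y b) u x) \<bullet> b)"
    by (intro dir_deriv_eq has_derivative_sum has_derivative_inner_left has_derivative_add
        has_derivative_const has_derivative_dir_deriv smooth_on_differentiable[OF smooth_hess x])
  also have "\<dots> = endo_trace (\<lambda>v. dir_deriv (\<lambda>y. hess y v) u x + \<Gamma> x u (hess x v)) - endo_trace (\<lambda>v. \<Gamma> x u (hess x v))"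
    by (simp add: endo_trace_add) (simp add: endo_trace_def)
  also have "endo_trace (\<lambda>v. \<Gamma> x u (hess x v)) = endo_trace (\<lambda>v. hess x (\<Gamma> x u v))"
    by (rule endo_trace_commute[OF christoffel_linear(1)[OF x] linear_hess[OF x]])
  finally show ?thesis
    by (simp add: endo_trace_diff[symmetric] nabla_hess_def[abs_def] nabla_endo_def nabla_def)
qed

lemma grad_scal:
  assumes x: "x \<in> U"
  shows "grad G (scal G) x = (- 2) *\<^sub>R (soliton_field x + hess x (soliton_field x))"
  unfolding grad_def
proof (rule sharp_eqI[of G x, OF metric[OF x]])
  have "Ric G x u (soliton_field x) = G x (soliton_field x + hess x (soliton_field x)) u" for u
    using hess_sym[OF x, of u "soliton_field x"] metric_sym[OF x, of u]
    by (simp add: Ric_eq x metric_bilinear_simps)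
  then show "G x ((- 2) *\<^sub>R (soliton_field x + hess x (soliton_field x))) w = dir_deriv (scal G) w x" for w
    by (simp only: dir_deriv_scal[OF x] trace_nabla_hess[OF x] metric_bilinear_simps(7)[OF x] real_scaleR_def)
qed

text \<open>Extremality, by the formula for the gradient of the scalar curvature: of the three terms
  $Au$, $B(u,X)$, $A^2u$ of the covariant derivative of $X + AX$, the outer two commute with $J$ anyway.\<close>

lemma nabla_hess_J_soliton_field:
  assumes x: "x \<in> U"
  shows "nabla_hess x (J x u) (soliton_field x) = J x (nabla_hess x u (soliton_field x))"
proof -
  \<comment> \<open>The explicit form of the gradient of the scalar curvature, which is visibly smooth.\<close>
  define V where "V y = (- 2) *\<^sub>R (soliton_field y + hess y (soliton_field y))" for y
  have sHX: "smooth_on (\<lambda>y. hess y (soliton_field y)) U"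
    by (rule smooth_on_family_apply[OF open_U smooth_linear_hess smooth_soliton_field])
  have sY: "smooth_on (\<lambda>y. soliton_field y + hess y (soliton_field y)) U"
    by (rule smooth_on_add[OF open_U smooth_soliton_field sHX])
  have sV: "smooth_on V U"
    unfolding V_def[abs_def] by (rule smooth_on_scaleR[OF open_U smooth_on_const sY])
  have "del_sharp G J (scal G) y = part10 J y (V y, 0)" if "y \<in> U" for y
    by (simp add: del_sharp_def grad_scal[OF that] V_def)
  then have eq: "(fst \<circ> del_sharp G J (scal G)) y = (fst \<circ> (\<lambda>y. part10 J y (V y, 0))) y"
    "(snd \<circ> del_sharp G J (scal G)) y = (snd \<circ> (\<lambda>y. part10 J y (V y, 0))) y" if "y \<in> U" for y
    using that by simp_all
  have "lie_bracket P (fst \<circ> del_sharp G J (scal G)) x = lie_bracket P (fst \<circ> (\<lambda>y. part10 J y (V y, 0))) x"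
    "lie_bracket P (snd \<circ> del_sharp G J (scal G)) x = lie_bracket P (snd \<circ> (\<lambda>y. part10 J y (V y, 0))) x" for P
    using dir_deriv_cong[OF open_U x, of "fst \<circ> del_sharp G J (scal G)", OF eq(1)]
      dir_deriv_cong[OF open_U x, of "snd \<circ> del_sharp G J (scal G)", OF eq(2)] eq[OF x]
    unfolding lie_bracket_def by metis+
  then have "dbar J (\<lambda>y. part10 J y (V y, 0)) x u = 0"
    using extremal[OF x, of u] by (simp add: dbar_def complex_bracket_def)
  then have V: "nabla (J x u) V x = J x (nabla u V x)"
    by (rule holomorphic_field[OF x sV])
  have "nabla w V x = (- 2) *\<^sub>R (hess x w + (nabla_hess x w (soliton_field x) + hess x (hess x w)))" for w
  proof -
    have "nabla w (\<lambda>y. hess y (soliton_field y)) x = nabla_hess x w (soliton_field x) + hess x (hess x w)"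
      using nabla_endo_apply[OF x smooth_linear_hess smooth_soliton_field, of w] by (simp add: hess_def nabla_hess_def)
    then show ?thesis
      using nabla_scaleR[OF x sY, of w "- 2"] nabla_add[OF x smooth_soliton_field sHX, of w]
      by (simp add: V_def[abs_def] hess_def[symmetric])
  qed
  with V show ?thesis
    by (simp add: J_simps x hess_J)
qed

text \<open>$B(X,JX) = J B(X,X) = B(JX,X)$, and the difference of the outer terms is the curvature.\<close>

lemma Rm_soliton_field:
  "x \<in> U \<Longrightarrow> Rm G x (soliton_field x) (J x (soliton_field x)) (soliton_field x) = 0"
  using nabla_hess_codazzi[of x "soliton_field x" "J x (soliton_field x)"]
    nabla_hess_J_soliton_field[of x "soliton_field x"] nabla_hess_J[of x "soliton_field x" "soliton_field x"]
  by simp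

lemma Ric_eq_metric_if_positive:
  assumes pos: "\<And>x u. x \<in> U \<Longrightarrow> u \<noteq> 0 \<Longrightarrow> G x (Rm G x u (J x u) (J x u)) u > 0"
    and x: "x \<in> U"
  shows "Ric G x u v = G x u v"
proof -
  have X0: "soliton_field y = 0" if y: "y \<in> U" for y
  proof (rule ccontr)
    assume "soliton_field y \<noteq> 0"
    moreover have "Rm G y (soliton_field y) (J y (soliton_field y)) (J y (soliton_field y)) = 0"
      by (simp add: Rm_J Rm_soliton_field J_simps y)
    ultimately show False
      using pos[OF y, of "soliton_field y"] by (simp add: metric_bilinear_simps y)
  qed
  have "hess x u = nabla u (\<lambda>_. 0) x"
    unfolding hess_def by (rule nabla_cong[OF x X0])
  then show ?thesis
    by (simp add: Ric_eq x nabla_const linear_0[OF christoffel_linear(1)])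
qed

end

theorem theorem2p7:
  fixes M :: "'m topology"
    and \<A> :: "('m, 'e::euclidean_space) chart set"
    and g :: "('m, 'e) chart \<Rightarrow> 'e bilinear_field"
    and J :: "('m, 'e) chart \<Rightarrow> 'e \<Rightarrow> 'e \<Rightarrow> 'e"
    and f :: "'m \<Rightarrow> real"
    and n :: nat
  assumes "DIM('e) = 2 * n"
    and "compact_space M"
    and "kahler_manifold M \<A> g J"
    and "smooth_function \<A> f"
    and "extremal_kahler_ricci_soliton \<A> g J f"
    and "positive_holomorphic_sectional_curvature \<A> g J"
  shows "einstein \<A> g"
  unfolding einstein_def
proof (intro exI ballI allI)
  fix c x u v
  assume c: "c \<in> \<A>" and x: "x \<in> chart_image c"
  have mfd: "smooth_manifold M \<A>" and met: "riemannian_metric \<A> g"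
    and J: "integrable_complex_structure \<A> J"
    and kahler: "\<And>x u v. x \<in> chart_image c \<Longrightarrow> g c x (J c x u) (J c x v) = g c x u v"
      "\<And>x u v w. x \<in> chart_image c \<Longrightarrow> ext_deriv2 (kahler_form (g c) (J c)) x u v w = 0"
    using assms(3) c unfolding kahler_manifold_def by blast+
  have J': "almost_complex_structure \<A> J"
    and nij: "\<And>x u v. x \<in> chart_image c \<Longrightarrow> nijenhuis (J c) x u v = 0"
    using J c unfolding integrable_complex_structure_def by blast+
  have sol: "kahler_ricci_soliton \<A> g f" and ext: "calabi_extremal \<A> g J"
    using assms(5) unfolding extremal_kahler_ricci_soliton_def by blast+
  interpret extremal_soliton_domain "chart_image c" "g c" "J c" "f \<circ> chart_inv c"
  proof (intro extremal_soliton_domain.intro kahler_domain.intro riemannian_domain.intro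
      kahler_domain_axioms.intro extremal_soliton_domain_axioms.intro)
    show "open (chart_image c)"
      using mfd c unfolding smooth_manifold_def by blast
    show "smooth_on (\<lambda>x. g c x u v) (chart_image c)" for u v
      using met c unfolding riemannian_metric_def by blast
    show "inner_product_form (g c x)" if "x \<in> chart_image c" for x
      using met c that unfolding riemannian_metric_def inner_product_form_def by blast
    show "smooth_on (\<lambda>x. J c x u) (chart_image c)" for u
      using J' c unfolding almost_complex_structure_def by blast
    show "linear (J c x)" if "x \<in> chart_image c" for x
      using J' c that unfolding almost_complex_structure_def by blast
    show "J c x (J c x u) = - u" if "x \<in> chart_image c" for x u
      using J' c that unfolding almost_complex_structure_def by blast
    show "smooth_on (f \<circ> chart_inv c) (chart_image c)"
      using assms(4) c unfolding smooth_function_def by blast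
    show "Ric (g c) x u v - g c x u v
        = 1 / 2 * lie_derivative (grad (g c) (f \<circ> chart_inv c)) (g c) x u v"
      if "x \<in> chart_image c" for x u v
      using sol c that unfolding kahler_ricci_soliton_def by blast
    show "dbar (J c) (del_sharp (g c) (J c) (scal (g c))) x u = 0" if "x \<in> chart_image c" for x u
      using ext c that unfolding calabi_extremal_def by blast
  qed (fact kahler nij)+
  show "Ric (g c) x u v = 1 * g c x u v"
    using Ric_eq_metric_if_positive[OF _ x, of u v] assms(6) c
    unfolding positive_holomorphic_sectional_curvature_def by simp
qed

end
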